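(* There is a probability measure $\nu$ on $(\Omega,\mathcal{F})$ such that, as $n\to\infty$, the random adjacency matrices $A^{(n)}$ (with distributions $\mu_n$, viewed as probability measures on $(\Omega,\mathcal{F})$) converge in distribution to a random adjacency matrix $A$ of the graph $G=(V,E)$ having distribution $\nu$; that is, $\mu_n$ converges weakly to $\nu$ on $(\Omega,\mathcal{F})$.
   Context: Let $\alpha>0$ and $\beta\ge 0$ be fixed parameters. Let $G^{(n)}=(V^{(n)},E^{(n)})$, $n=1,2,\dots$, be any sequence of finite simple undirected graphs such that $V^{(n)}\subset V^{(n+1)}$, $E^{(n)}\subset E^{(n+1)}$, and $|E^{(n)}|\to\infty$. For $a\in\{0,1\}^{E^{(n)}}$ let $$Q(a)=\alpha I+\beta\sum_{(i,j)\in E^{(n)}}a_{ij}(e_i-e_j)(e_i-e_j)^T,\qquad \Sigma(a)=Q(a)^{-1},$$ matrices indexed by $V^{(n)}\times V^{(n)}$, where $e_i$ is the $i$th standard basis vector of $\mathbb{R}^{V^{(n)}}$ and each edge is counted once ($Q(a)$ is positive definite). The random adjacency matrix $A^{(n)}$ on $G^{(n)}$ (identified with its edge configuration in $\{0,1\}^{E^{(n)}}$) has distribution $$\mu_n(a)=\frac{|\Sigma(a)|^{1/2}}{\sum_{b\in\{0,1\}^{E^{(n)}}}|\Sigma(b)|^{1/2}},\qquad a\in\{0,1\}^{E^{(n)}},$$ where $|\cdot|$ is the determinant. Let $V=\bigcup_n V^{(n)}$, $E=\bigcup_n E^{(n)}$, $\Omega=\{0,1\}^E$ (with the product topology), and let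 $\mathcal{F}$ be the $\sigma$-field generated by the cylinder events of $\Omega$. Each $\mu_n$ is viewed as a probability measure on $(\Omega,\mathcal{F})$ supported on $\Omega_n=\{0,1\}^{E^{(n)}}\times\{0\}^{E\setminus E^{(n)}}$. Weak convergence $\mu_n\to\nu$ is equivalent to $\lim_n\mu_n(B)=\nu(B)$ for every finite-dimensional cylinder event $B$ (event depending on finitely many edges). *)

theory Defs
  imports
    "HOL-Probability.Probability_Measure"
    "Jordan_Normal_Form.Determinant"
    "Jordan_Normal_Form.Gauss_Jordan_Elimination"
begin

text \<open>Undirected edges are two-element vertex sets, so that every edge is counted once.\<close>

definition finite_simple_graph :: "'v set \<Rightarrow> 'v set set \<Rightarrow> bool" where
  "finite_simple_graph V E \<longleftrightarrow> finite V \<and> (\<forall>e\<in>E. e \<subseteq> V \<and> card e = 2)"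

text \<open>A configuration in \<open>{0,1}\<^sup>E\<close> is an element of \<open>E \<rightarrow>\<^sub>E UNIV\<close> with values in \<^typ>\<open>bool\<close>
  (\<^const>\<open>True\<close> for 1); being extensional, it is \<^const>\<open>undefined\<close> outside \<open>E\<close>.
  The \<open>\<sigma>\<close>-field of \<^term>\<open>Pi\<^sub>M\<close> is the one generated by the cylinder events.\<close>

definition config_space :: "'v set set \<Rightarrow> ('v set \<Rightarrow> bool) measure" where
  "config_space E = Pi\<^sub>M E (\<lambda>_. count_space UNIV)"

definition config_topology :: "'v set set \<Rightarrow> ('v set \<Rightarrow> bool) topology" where
  "config_topology E = product_topology (\<lambda>_. discrete_topology UNIV) E"

definition std_basis :: "'v \<Rightarrow> 'v \<Rightarrow> real" where
  "std_basis i = (\<lambda>u. of_bool (u = i))"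

text \<open>The vector \<open>e\<^sub>i - e\<^sub>j\<close> of the edge \<open>{i, j}\<close>. It is determined only up to sign, which is
  irrelevant in the rank-one matrix built from it (see the lemma below).\<close>

definition edge_vec :: "'v set \<Rightarrow> 'v \<Rightarrow> real" where
  "edge_vec e = (SOME b. \<exists>i j. i \<noteq> j \<and> e = {i, j} \<and> b = (\<lambda>u. std_basis i u - std_basis j u))"

lemma edge_vec_outer:
  assumes "i \<noteq> j"
  shows "edge_vec {i, j} u * edge_vec {i, j} v =
    (std_basis i u - std_basis j u) * (std_basis i v - std_basis j v)"
proof -
  have "\<exists>b k l. k \<noteq> l \<and> {i, j} = {k, l} \<and> b = (\<lambda>u. std_basis k u - std_basis l u)"
    using assms by blast
  then have "\<exists>k l. k \<noteq> l \<and> {i, j} = {k, l} \<and>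
      edge_vec {i, j} = (\<lambda>u. std_basis k u - std_basis l u)"
    unfolding edge_vec_def by (rule someI_ex)
  then obtain k l where kl: "{i, j} = {k, l}"
    and b: "edge_vec {i, j} = (\<lambda>u. std_basis k u - std_basis l u)" by blast
  from kl consider "k = i" "l = j" | "k = j" "l = i" by (auto simp: doubleton_eq_iff)
  then show ?thesis by cases (simp_all add: b algebra_simps)
qed

text \<open>The entries of \<open>Q(a)\<close>, indexed by pairs of vertices.\<close>

definition Q_entry :: "real \<Rightarrow> real \<Rightarrow> 'v set set \<Rightarrow> ('v set \<Rightarrow> bool) \<Rightarrow> 'v \<Rightarrow> 'v \<Rightarrow> real" where
  "Q_entry \<alpha> \<beta> E a u v =
     \<alpha> * of_bool (u = v) + \<beta> * (\<Sum>e\<in>E. of_bool (a e) * (edge_vec e u * edge_vec e v))"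

text \<open>For finite \<open>V\<close>, \<^term>\<open>from_nat_into V\<close> is a bijection from \<open>{..<card V}\<close> onto \<open>V\<close>; it serves
  to turn a matrix indexed by \<open>V \<times> V\<close> into a library matrix. The determinant of the inverse does
  not depend on the enumeration.\<close>

definition Q_mat ::
    "real \<Rightarrow> real \<Rightarrow> 'v set \<Rightarrow> 'v set set \<Rightarrow> ('v set \<Rightarrow> bool) \<Rightarrow> real mat" where
  "Q_mat \<alpha> \<beta> V E a = mat (card V) (card V)
     (\<lambda>(k, l). Q_entry \<alpha> \<beta> E a (from_nat_into V k) (from_nat_into V l))"

text \<open>\<^const>\<open>mat_inverse\<close> returns an option; for \<open>\<alpha> > 0\<close> and \<open>\<beta> \<ge> 0\<close> the matrix \<open>Q(a)\<close> is positive
  definite, hence the inverse exists.\<close>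

definition Sigma_mat ::
    "real \<Rightarrow> real \<Rightarrow> 'v set \<Rightarrow> 'v set set \<Rightarrow> ('v set \<Rightarrow> bool) \<Rightarrow> real mat" where
  "Sigma_mat \<alpha> \<beta> V E a = the (mat_inverse (Q_mat \<alpha> \<beta> V E a))"

definition adj_weight ::
    "real \<Rightarrow> real \<Rightarrow> 'v set \<Rightarrow> 'v set set \<Rightarrow> ('v set \<Rightarrow> bool) \<Rightarrow> real" where
  "adj_weight \<alpha> \<beta> V E a = sqrt (Determinant.det (Sigma_mat \<alpha> \<beta> V E a))"

definition adj_prob ::
    "real \<Rightarrow> real \<Rightarrow> 'v set \<Rightarrow> 'v set set \<Rightarrow> ('v set \<Rightarrow> bool) \<Rightarrow> real" where
  "adj_prob \<alpha> \<beta> V E a =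
     adj_weight \<alpha> \<beta> V E a / (\<Sum>b\<in>E \<rightarrow>\<^sub>E UNIV. adj_weight \<alpha> \<beta> V E b)"

definition adj_measure ::
    "real \<Rightarrow> real \<Rightarrow> 'v set \<Rightarrow> 'v set set \<Rightarrow> ('v set \<Rightarrow> bool) measure" where
  "adj_measure \<alpha> \<beta> V E = point_measure (E \<rightarrow>\<^sub>E UNIV) (\<lambda>a. ennreal (adj_prob \<alpha> \<beta> V E a))"

text \<open>The embedding of \<open>{0,1}\<^sup>F\<close> into \<open>{0,1}\<^sup>E\<close>, for \<open>F \<subseteq> E\<close>, that puts 0 on \<open>E - F\<close>.\<close>

definition extend_config :: "'v set set \<Rightarrow> 'v set set \<Rightarrow> ('v set \<Rightarrow> bool) \<Rightarrow> 'v set \<Rightarrow> bool" where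
  "extend_config F E a = (\<lambda>e\<in>E. e \<in> F \<and> a e)"

definition extended_adj_measure ::
    "real \<Rightarrow> real \<Rightarrow> 'v set \<Rightarrow> 'v set set \<Rightarrow> 'v set set \<Rightarrow> ('v set \<Rightarrow> bool) measure" where
  "extended_adj_measure \<alpha> \<beta> V F E =
     distr (adj_measure \<alpha> \<beta> V F) (config_space E) (extend_config F E)"

text \<open>Weak convergence, tested against bounded continuous functions. The library's
  \<open>weak_conv_m\<close> covers only measures on the real line.\<close>

definition weakly_converges :: "'a topology \<Rightarrow> (nat \<Rightarrow> 'a measure) \<Rightarrow> 'a measure \<Rightarrow> bool" where
  "weakly_converges T M N \<longleftrightarrow>
     (\<forall>f :: 'a \<Rightarrow> real. continuous_map T euclidean f \<and> bounded (f ` topspace T) \<longrightarrow>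
        (\<lambda>n. \<integral>x. f x \<partial>M n) \<longlonglongrightarrow> (\<integral>x. f x \<partial>N))"

end

theory Submission
  imports Defs
begin

text \<open>\<open>\<mu>\<^sub>n\<close> is \<open>\<mu>\<^sub>n\<^sub>+\<^sub>1\<close> conditioned on having no edge outside the \<open>n\<close>-th edge set. Since \<open>det Q\<close> is
  log-submodular in the set of present edges, its power \<open>-1/2\<close> is log-supermodular, and by the four
  functions theorem such a conditioning can only decrease the probability that all edges of a given
  finite set are present. These probabilities are therefore nondecreasing in \<open>n\<close>, hence
  convergent; by inclusion-exclusion so are the probabilities of all cylinder events. The limits
  form a premeasure on the algebra of cylinder events, because these are clopen in a compact space,
  and its extension is the weak limit, because continuous functions are uniformly approximated by
  functions of finitely many edges.\<close>

section \<open>Determinants of low-rank perturbations\<close>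

text \<open>Passing to the next graph changes the size of \<open>Q\<close> as well as the edge set,
  so the conditioning relation between consecutive measures is not immediate. It holds because
  vertices that meet none of the allowed edges contribute only a power of \<alpha> to the
  determinant; this factor is the same for all edge sets and cancels on normalization.
  Log-submodularity is a matter of two edges. Relative to the inverse of \<open>Q\<close>, adding
  edges multiplies the determinant by that of a small matrix, the identity plus \<beta> times a Gram
  matrix. For two edges this is the product of the single-edge factors minus the square of the
  off-diagonal entry. Presence events are tracked because they are increasing, which the four
  functions argument exploits, and because they still determine the probabilities of all cylinder
  events.\<close>

lemma det_add_mult:
  fixes Q :: "'a :: idom mat"
  assumes Q: "Q \<in> carrier_mat n n" and R: "R \<in> carrier_mat n n" and QR: "Q * R = 1\<^sub>m n"
    and U: "U \<in> carrier_mat n m" and W: "W \<in> carrier_mat m n"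
  shows "Determinant.det (Q + U * W) = Determinant.det Q * Determinant.det (1\<^sub>m m + W * (R * U))"
proof -
  \<comment> \<open>Both sides are the determinant of \<open>?M\<close>. Multiplying by
    \<open>?S\<close> clears the upper right block and leaves \<open>Q + U * W\<close>; multiplying
    by \<open>?T\<close> clears the lower left block because \<open>Q * R\<close> is the identity.
    Both multipliers are unitriangular.\<close>
  let ?M = "four_block_mat (1\<^sub>m m) (-W) U Q"
  let ?S = "four_block_mat (1\<^sub>m m) W (0\<^sub>m n m) (1\<^sub>m n)"
  let ?T = "four_block_mat (1\<^sub>m m) (0\<^sub>m m n) (-(R * U)) (1\<^sub>m n)"
  have M: "?M \<in> carrier_mat (m + n) (m + n)" using assms by auto
  have S: "?S \<in> carrier_mat (m + n) (m + n)" using assms by auto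
  have T: "?T \<in> carrier_mat (m + n) (m + n)" using assms by auto
  have RU: "R * U \<in> carrier_mat n m" using R U by auto
  have detS: "Determinant.det ?S = 1"
    by (subst det_four_block_mat_lower_left_zero[of _ m _ n]) (use W in auto)
  have detT: "Determinant.det ?T = 1"
    by (subst det_four_block_mat_upper_right_zero[of _ m _ n]) (use RU in auto)
  have "?M * ?S = four_block_mat (1\<^sub>m m) (0\<^sub>m m n) U (Q + U * W)"
    by (subst mult_four_block_mat[of _ m m _ n _ n _ _ m _ n])
      (use Q U W in \<open>auto simp: comm_add_mat[of "U * W" n n Q]\<close>)
  moreover have "Determinant.det (four_block_mat (1\<^sub>m m) (0\<^sub>m m n) U (Q + U * W)) =
      Determinant.det (Q + U * W)"
    by (subst det_four_block_mat_upper_right_zero[of _ m _ n]) (use Q U W in auto)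
  ultimately have 1: "Determinant.det ?M = Determinant.det (Q + U * W)"
    using det_mult[OF M S] detS by simp
  have "Q * (R * U) = U"
    using assoc_mult_mat[OF Q R U] QR U by simp
  moreover have "Q * -(R * U) = - (Q * (R * U))"
    using Q RU by (intro uminus_mult_right_mat) auto
  moreover have "U + - U = 0\<^sub>m n m"
    using U by (intro eq_matI) auto
  ultimately have 21: "U * 1\<^sub>m m + Q * -(R * U) = 0\<^sub>m n m"
    using U by simp
  have l: "-W * -(R * U) = - (W * -(R * U))"
    by (rule uminus_mult_left_mat) (use W RU in auto)
  have r: "W * -(R * U) = - (W * (R * U))"
    by (rule uminus_mult_right_mat) (use W RU in auto)
  have 11: "1\<^sub>m m * 1\<^sub>m m + -W * -(R * U) = 1\<^sub>m m + W * (R * U)"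
    unfolding l r by simp
  have 12: "1\<^sub>m m * 0\<^sub>m m n + -W * 1\<^sub>m n = -W" and 22: "U * 0\<^sub>m m n + Q * 1\<^sub>m n = Q"
    using W Q U by simp_all
  have "?M * ?T = four_block_mat (1\<^sub>m m + W * (R * U)) (-W) (0\<^sub>m n m) Q"
    unfolding mult_four_block_mat[OF one_carrier_mat uminus_carrier_mat[OF W] U Q
        one_carrier_mat zero_carrier_mat uminus_carrier_mat[OF RU] one_carrier_mat] 11 12 21 22 ..
  moreover have "Determinant.det (four_block_mat (1\<^sub>m m + W * (R * U)) (-W) (0\<^sub>m n m) Q) =
      Determinant.det (1\<^sub>m m + W * (R * U)) * Determinant.det Q"
    by (subst det_four_block_mat_lower_left_zero[of _ m _ n]) (use Q U W RU in auto)
  ultimately have 2: "Determinant.det ?M = Determinant.det (1\<^sub>m m + W * (R * U)) * Determinant.det Q"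
    using det_mult[OF M T] detT by simp
  from 1 2 show ?thesis by (simp add: mult.commute)
qed

lemma det_2x2:
  fixes A :: "'a :: comm_ring_1 mat"
  assumes "A \<in> carrier_mat 2 2"
  shows "Determinant.det A = A $$ (0,0) * A $$ (1,1) - A $$ (0,1) * A $$ (1,0)"
  using assms
  by (subst laplace_expansion_row[of _ 2 0])
    (auto simp: numeral_2_eq_2 cofactor_def det_single mat_delete_def)

section \<open>The determinant of \<open>Q\<close> as a function of the edge set\<close>

abbreviation edge_col :: "'v set \<Rightarrow> 'v set \<Rightarrow> real Matrix.vec" where
  "edge_col V e \<equiv> Matrix.vec (card V) (\<lambda>k. edge_vec e (from_nat_into V k))"

text \<open>Configurations enter as sets of present edges, so that union and intersection are the
  lattice operations of the later inequalities.\<close>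

definition Q_set :: "real \<Rightarrow> real \<Rightarrow> 'v set \<Rightarrow> 'v set set \<Rightarrow> real mat" where
  "Q_set \<alpha> \<beta> V A = Q_mat \<alpha> \<beta> V A (\<lambda>_. True)"

lemma Q_set_carrier [simp]: "Q_set \<alpha> \<beta> V A \<in> carrier_mat (card V) (card V)"
  by (simp add: Q_set_def Q_mat_def)

lemma Q_mat_eq_Q_set:
  assumes "finite E"
  shows "Q_mat \<alpha> \<beta> V E a = Q_set \<alpha> \<beta> V {e\<in>E. a e}"
proof -
  have "(\<Sum>e\<in>E. of_bool (a e) * f e) = (\<Sum>e\<in>{e\<in>E. a e}. f e)" for f :: "_ \<Rightarrow> real"
    by (subst sum.inter_filter[OF assms]) (auto intro!: sum.cong)
  then show ?thesis
    by (simp add: Q_set_def Q_mat_def Q_entry_def)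
qed

lemma from_nat_into_eq_iff:
  assumes "finite V" "i < card V" "j < card V"
  shows "from_nat_into V i = from_nat_into V j \<longleftrightarrow> i = j"
  using bij_betw_from_nat_into_finite[OF assms(1)] assms(2,3)
  by (auto simp: bij_betw_def inj_on_def)

lemma Q_set_empty:
  assumes "finite V"
  shows "Q_set \<alpha> \<beta> V {} = \<alpha> \<cdot>\<^sub>m 1\<^sub>m (card V)"
  by (rule eq_matI) (auto simp: Q_set_def Q_mat_def Q_entry_def from_nat_into_eq_iff assms)

lemma Q_set_symmetric:
  assumes "k < card V" "l < card V"
  shows "Q_set \<alpha> \<beta> V A $$ (k, l) = Q_set \<alpha> \<beta> V A $$ (l, k)"
  using assms by (auto simp: Q_set_def Q_mat_def Q_entry_def mult.commute eq_commute)

text \<open>The rank-one matrices of the new edges add up to one product, the columns of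
  \<open>U\<close> being the edge vectors. The edges form a list because columns are
  ordered.\<close>

lemma Q_set_Un:
  fixes V :: "'v set"
  assumes "finite A" "distinct es" "set es \<inter> A = {}"
  defines "U \<equiv> mat_of_cols (card V) (map (edge_col V) es)"
  shows "Q_set \<alpha> \<beta> V (A \<union> set es) = Q_set \<alpha> \<beta> V A + U * (\<beta> \<cdot>\<^sub>m transpose_mat U)"
proof (rule eq_matI)
  fix k l assume "k < dim_row (Q_set \<alpha> \<beta> V A + U * (\<beta> \<cdot>\<^sub>m transpose_mat U))"
    "l < dim_col (Q_set \<alpha> \<beta> V A + U * (\<beta> \<cdot>\<^sub>m transpose_mat U))"
  then have kl: "k < card V" "l < card V"
    by (simp_all add: U_def)
  let ?f = "\<lambda>e. edge_vec e (from_nat_into V k) * edge_vec e (from_nat_into V l)"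
  have "(U * (\<beta> \<cdot>\<^sub>m transpose_mat U)) $$ (k, l) =
      (\<Sum>j<length es. edge_vec (es ! j) (from_nat_into V k) *
        (\<beta> * edge_vec (es ! j) (from_nat_into V l)))"
    using kl by (simp add: U_def scalar_prod_def mat_of_cols_def atLeast0LessThan)
  also have "\<dots> = \<beta> * (\<Sum>e\<in>set es. ?f e)"
    using assms(2)
    by (simp add: sum_list_distinct_conv_sum_set[symmetric] sum_list_sum_nth atLeast0LessThan
        sum_distrib_left mult_ac)
  finally have prod: "(U * (\<beta> \<cdot>\<^sub>m transpose_mat U)) $$ (k, l) = \<beta> * (\<Sum>e\<in>set es. ?f e)" .
  have "(\<Sum>e\<in>A \<union> set es. ?f e) = (\<Sum>e\<in>A. ?f e) + (\<Sum>e\<in>set es. ?f e)"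
    using assms by (intro sum.union_disjoint) auto
  then show "Q_set \<alpha> \<beta> V (A \<union> set es) $$ (k, l) =
      (Q_set \<alpha> \<beta> V A + U * (\<beta> \<cdot>\<^sub>m transpose_mat U)) $$ (k, l)"
    using kl
    by (subst index_add_mat(1)) (simp_all add: prod[unfolded U_def] U_def Q_set_def Q_mat_def Q_entry_def distrib_left
        del: index_mult_mat(1))
qed (simp_all add: U_def Q_set_def Q_mat_def)

text \<open>This trades a determinant of size \<open>card V\<close> for one whose size is the number
  of new edges. It is applied with one edge, with two, and with all edges at once starting from the
  empty set.\<close>

lemma det_Q_set_Un:
  assumes "finite A" "distinct es" "set es \<inter> A = {}"
    and R: "R \<in> carrier_mat (card V) (card V)" "Q_set \<alpha> \<beta> V A * R = 1\<^sub>m (card V)"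
  shows "Determinant.det (Q_set \<alpha> \<beta> V (A \<union> set es)) = Determinant.det (Q_set \<alpha> \<beta> V A) *
    Determinant.det (Matrix.mat (length es) (length es) (\<lambda>(i, j). of_bool (i = j) +
      \<beta> * (edge_col V (es ! i) \<bullet> (R *\<^sub>v edge_col V (es ! j)))))"
proof -
  define U where "U = mat_of_cols (card V) (map (edge_col V) es)"
  have U: "U \<in> carrier_mat (card V) (length es)"
    by (auto simp: U_def)
  have "1\<^sub>m (length es) + \<beta> \<cdot>\<^sub>m transpose_mat U * (R * U) = 
     Matrix.mat (length es) (length es) (\<lambda>(i, j). of_bool (i = j) +
      \<beta> * (edge_col V (es ! i) \<bullet> (R *\<^sub>v edge_col V (es ! j))))" (is "?L = ?N")
  proof (rule eq_matI)
    fix i j assume "i < dim_row ?N" "j < dim_col ?N"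
    then have ij: "i < length es" "j < length es" by auto
    have "(\<beta> \<cdot>\<^sub>m transpose_mat U * (R * U)) $$ (i, j) = \<beta> * (transpose_mat U * (R * U)) $$ (i, j)"
      using U R ij by (subst mult_smult_assoc_mat) auto
    also have "(transpose_mat U * (R * U)) $$ (i, j) = col U i \<bullet> (R *\<^sub>v col U j)"
      using U R ij by (subst index_mult_mat) (auto simp: col_mult2[of _ "card V" "card V" _ "length es"])
    also have "\<dots> = edge_col V (es ! i) \<bullet> (R *\<^sub>v edge_col V (es ! j))"
      using ij by (simp add: U_def)
    finally show "?L $$ (i, j) = ?N $$ (i, j)"
      using U R ij by (subst index_add_mat(1)) (simp_all only: index_one_mat index_mat prod.case of_bool_def, auto)
  qed (use U R in auto)
  then show ?thesis
    unfolding Q_set_Un[OF assms(1-3)] U_def[symmetric]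
    by (subst det_add_mult[OF Q_set_carrier R U]) (use U in auto)
qed

section \<open>Positivity and submodularity of the determinant\<close>

lemma Q_set_mult_scalar_symmetric:
  assumes "x \<in> carrier_vec (card V)" "y \<in> carrier_vec (card V)"
  shows "(Q_set \<alpha> \<beta> V A *\<^sub>v x) \<bullet> y = (Q_set \<alpha> \<beta> V A *\<^sub>v y) \<bullet> x"
proof -
  have d: "dim_row (Q_set \<alpha> \<beta> V A) = card V" "dim_col (Q_set \<alpha> \<beta> V A) = card V"
    by (simp_all add: Q_set_def Q_mat_def)
  have "(Q_set \<alpha> \<beta> V A *\<^sub>v x) \<bullet> y =
    (\<Sum>k<card V. \<Sum>l<card V. Q_set \<alpha> \<beta> V A $$ (k, l) * x $ l * y $ k)"
    using assms by (auto simp: scalar_prod_def sum_distrib_right d atLeast0LessThan)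
  also have "\<dots> = (\<Sum>l<card V. \<Sum>k<card V. Q_set \<alpha> \<beta> V A $$ (k, l) * x $ l * y $ k)"
    by (rule sum.swap)
  also have "\<dots> = (\<Sum>l<card V. \<Sum>k<card V. Q_set \<alpha> \<beta> V A $$ (l, k) * y $ k * x $ l)"
    by (intro sum.cong refl) (auto simp: Q_set_symmetric[of _ V])
  also have "\<dots> = (Q_set \<alpha> \<beta> V A *\<^sub>v y) \<bullet> x"
    using assms by (auto simp: scalar_prod_def sum_distrib_right d atLeast0LessThan)
  finally show ?thesis .
qed

text \<open>The form equals \<alpha> times the squared norm of \<open>x\<close> plus \<beta> times
  the sum of the squared inner products of \<open>x\<close> with the edge vectors.\<close>

lemma Q_set_nonneg:
  assumes "finite V" "\<alpha> \<ge> 0" "\<beta> \<ge> 0" and x: "x \<in> carrier_vec (card V)"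
  shows "(Q_set \<alpha> \<beta> V A *\<^sub>v x) \<bullet> x \<ge> 0"
proof -
  let ?b = "\<lambda>e k. edge_vec e (from_nat_into V k)"
  have "(Q_set \<alpha> \<beta> V A *\<^sub>v x) \<bullet> x =
    (\<Sum>k<card V. \<Sum>l<card V. Q_set \<alpha> \<beta> V A $$ (k, l) * x $ l * x $ k)"
    using x by (auto simp: scalar_prod_def sum_distrib_right Q_set_def Q_mat_def atLeast0LessThan)
  also have "\<dots> = (\<Sum>k<card V. \<Sum>l<card V. of_bool (k = l) * (\<alpha> * x $ l * x $ k)) +
     (\<Sum>k<card V. \<Sum>l<card V. \<Sum>e\<in>A. \<beta> * ((?b e k * x $ k) * (?b e l * x $ l)))"
    unfolding sum.distrib[symmetric]
    by (intro sum.cong refl)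
      (auto simp: Q_set_def Q_mat_def Q_entry_def from_nat_into_eq_iff assms algebra_simps
        sum_distrib_left)
  also have "(\<Sum>k<card V. \<Sum>l<card V. \<Sum>e\<in>A. \<beta> * ((?b e k * x $ k) * (?b e l * x $ l))) =
      \<beta> * (\<Sum>e\<in>A. (\<Sum>k<card V. ?b e k * x $ k)\<^sup>2)"
    by (simp only: sum.swap[of _ A "{..<card V}"] power2_eq_square sum_product)
      (simp only: sum_distrib_left)
  also have "(\<Sum>k<card V. \<Sum>l<card V. of_bool (k = l) * (\<alpha> * x $ l * x $ k)) =
      (\<Sum>k<card V. \<alpha> * (x $ k)\<^sup>2)"
    by (intro sum.cong refl) (simp add: power2_eq_square of_bool_def if_distrib[of "\<lambda>t. t * _"] mult.assoc cong: if_cong)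
  finally show ?thesis
    using assms by (simp add: sum_nonneg)
qed

text \<open>The equation for \<open>mat_inverse\<close> serves to unfold \<open>Sigma_mat\<close>;
  the determinant updates use the other two properties of \<open>R\<close>.\<close>

lemma right_inverse_exists:
  fixes Q :: "'a :: field mat"
  assumes "Q \<in> carrier_mat n n" "Determinant.det Q \<noteq> 0"
  obtains R where "R \<in> carrier_mat n n" "Q * R = 1\<^sub>m n" "mat_inverse Q = Some R"
proof -
  have "Q \<in> Units (ring_mat TYPE('a) n ())"
    using assms by (rule det_non_zero_imp_unit)
  then have "mat_inverse Q \<noteq> None"
    using mat_inverse(1)[OF assms(1), where b = "()"] by blast
  then obtain R where "mat_inverse Q = Some R" by blast
  with mat_inverse(2)[OF assms(1) this] show ?thesis
    using that by blast
qed

text \<open>Writing \<open>x\<close> as \<open>Q\<close> applied to \<open>R *\<^sub>v x\<close>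
  carries symmetry and nonnegativity over from the form of \<open>Q\<close> to that of its
  inverse.\<close>

lemma quadratic_form_inverse_Q_set:
  assumes R: "R \<in> carrier_mat (card V) (card V)" "Q_set \<alpha> \<beta> V A * R = 1\<^sub>m (card V)"
    and x: "x \<in> carrier_vec (card V)" and y: "y \<in> carrier_vec (card V)"
  shows "x \<bullet> (R *\<^sub>v y) = (Q_set \<alpha> \<beta> V A *\<^sub>v (R *\<^sub>v x)) \<bullet> (R *\<^sub>v y)"
proof -
  have "Q_set \<alpha> \<beta> V A *\<^sub>v (R *\<^sub>v x) = x"
    using assoc_mult_mat_vec[OF Q_set_carrier R(1) x, of \<alpha> \<beta> A] x unfolding R(2) by simp
  then show ?thesis by simp
qed

lemma det_Q_set_insert:
  assumes "finite A" "e \<notin> A"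
    and "R \<in> carrier_mat (card V) (card V)" "Q_set \<alpha> \<beta> V A * R = 1\<^sub>m (card V)"
  shows "Determinant.det (Q_set \<alpha> \<beta> V (insert e A)) =
    Determinant.det (Q_set \<alpha> \<beta> V A) * (1 + \<beta> * (edge_col V e \<bullet> (R *\<^sub>v edge_col V e)))"
  using det_Q_set_Un[of A "[e]" R V \<alpha> \<beta>] assms by (simp add: det_single)

text \<open>Positivity doubles as invertibility: the induction hypothesis supplies the inverse
  \<open>R\<close> for the next rank-one update, whose factor is at least 1.\<close>

lemma det_Q_set_pos:
  assumes "finite V" "\<alpha> > 0" "\<beta> \<ge> 0" "finite A"
  shows "Determinant.det (Q_set \<alpha> \<beta> V A) > 0"
  using assms(4)
proof (induction A rule: finite_induct)
  case empty
  then show ?case using assms by (simp add: Q_set_empty)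
next
  case (insert e A)
  obtain R where R: "R \<in> carrier_mat (card V) (card V)" "Q_set \<alpha> \<beta> V A * R = 1\<^sub>m (card V)"
    using right_inverse_exists[OF Q_set_carrier less_imp_neq[OF insert.IH, symmetric]] by blast
  have "edge_col V e \<bullet> (R *\<^sub>v edge_col V e) \<ge> 0"
    by (subst quadratic_form_inverse_Q_set[OF R]) (use assms R in \<open>auto intro!: Q_set_nonneg\<close>)
  with insert assms R show ?case
    by (simp add: det_Q_set_insert add_pos_nonneg)
qed

lemma det_Q_set_local_submodular:
  assumes "finite V" "\<alpha> > 0" "\<beta> \<ge> 0" "finite A" "e \<notin> A" "f \<notin> A" "e \<noteq> f"
  shows "Determinant.det (Q_set \<alpha> \<beta> V (insert e (insert f A))) * Determinant.det (Q_set \<alpha> \<beta> V A)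
    \<le> Determinant.det (Q_set \<alpha> \<beta> V (insert e A)) * Determinant.det (Q_set \<alpha> \<beta> V (insert f A))"
proof -
  have pos: "Determinant.det (Q_set \<alpha> \<beta> V A) > 0"
    using assms by (intro det_Q_set_pos) auto
  obtain R where R: "R \<in> carrier_mat (card V) (card V)" "Q_set \<alpha> \<beta> V A * R = 1\<^sub>m (card V)"
    using right_inverse_exists[OF Q_set_carrier less_imp_neq[OF pos, symmetric]] by blast
  define q where "q e f = edge_col V e \<bullet> (R *\<^sub>v edge_col V f)" for e f
  have sym: "q f e = q e f"
    unfolding q_def using R
    by (subst (1 2) quadratic_form_inverse_Q_set[OF R]) (auto intro!: Q_set_mult_scalar_symmetric)
  have "Determinant.det (Q_set \<alpha> \<beta> V (insert e (insert f A))) = Determinant.det (Q_set \<alpha> \<beta> V A) *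
      ((1 + \<beta> * q e e) * (1 + \<beta> * q f f) - (\<beta> * q e f)\<^sup>2)"
    using det_Q_set_Un[of A "[e, f]" R V \<alpha> \<beta>] assms R sym
    by (simp add: det_2x2 q_def[symmetric] power2_eq_square numeral_2_eq_2)
  also have "\<dots> * Determinant.det (Q_set \<alpha> \<beta> V A) \<le> Determinant.det (Q_set \<alpha> \<beta> V A) *
      ((1 + \<beta> * q e e) * (1 + \<beta> * q f f)) * Determinant.det (Q_set \<alpha> \<beta> V A)"
    using pos by (intro mult_right_mono mult_left_mono) auto
  also have "\<dots> = Determinant.det (Q_set \<alpha> \<beta> V (insert e A)) * Determinant.det (Q_set \<alpha> \<beta> V (insert f A))"
    using assms R by (simp add: det_Q_set_insert q_def)
  finally show ?thesis by simp
qed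

section \<open>Changing the ambient vertex set\<close>

lemma edge_vec_eq_0:
  assumes "card e = 2" "v \<notin> e"
  shows "edge_vec e v = 0"
proof -
  obtain i j where ij: "e = {i, j}" "i \<noteq> j"
    using assms(1) by (auto simp: card_2_iff)
  \<comment> \<open>The square is computed because \<open>edge_vec_outer\<close> controls only
    products, the sign of the vector being an arbitrary choice.\<close>
  have "edge_vec {i, j} v * edge_vec {i, j} v = 0"
    using ij assms by (subst edge_vec_outer) (auto simp: std_basis_def)
  then show ?thesis using ij by simp
qed

text \<open>Perturbing \<open>\<alpha> I\<close> by all edges at once expresses the determinant through the Gram matrix of
  the edge vectors, in which the ambient vertex set no longer occurs.\<close>
lemma det_Q_set_vertices:
  assumes V: "finite V'" "V \<subseteq> V'" and "\<alpha> > 0" and A: "finite_simple_graph V A" "finite A"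
  shows "\<alpha> ^ card V * Determinant.det (Q_set \<alpha> \<beta> V' A) =
    \<alpha> ^ card V' * Determinant.det (Q_set \<alpha> \<beta> V A)"
proof -
  obtain es where es: "set es = A" "distinct es"
    using finite_distinct_list[OF A(2)] by blast
  define G where "G = Matrix.mat (length es) (length es) (\<lambda>(i, j). of_bool (i = j) +
      \<beta> * ((\<Sum>v\<in>V. edge_vec (es ! i) v * edge_vec (es ! j) v) / \<alpha>))"
  \<comment> \<open>\<open>G\<close> sums over \<open>V\<close> alone, so one \<open>G\<close>
    serves both instances \<open>X = V\<close> and \<open>X = V'\<close>; the power of \<alpha>
    carries all the dependence on \<open>X\<close>.\<close>
  have det_eq: "Determinant.det (Q_set \<alpha> \<beta> X A) = \<alpha> ^ card X * Determinant.det G"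
    if X: "finite X" "V \<subseteq> X" for X
  proof -
    let ?R = "inverse \<alpha> \<cdot>\<^sub>m 1\<^sub>m (card X)"
    have R: "?R \<in> carrier_mat (card X) (card X)" "Q_set \<alpha> \<beta> X {} * ?R = 1\<^sub>m (card X)"
      using X \<open>\<alpha> > 0\<close> by (auto simp: Q_set_empty mult_smult_distrib[of _ _ "card X" _ "card X"])
    have q: "edge_col X e \<bullet> (?R *\<^sub>v edge_col X f) = (\<Sum>v\<in>V. edge_vec e v * edge_vec f v) / \<alpha>"
      if "e \<in> A" for e f
    proof -
      have "edge_col X e \<bullet> (?R *\<^sub>v edge_col X f) = inverse \<alpha> *
          (\<Sum>k<card X. edge_vec e (from_nat_into X k) * edge_vec f (from_nat_into X k))"
        by (simp add: scalar_prod_def atLeast0LessThan sum_distrib_left of_bool_def mult_ac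
            if_distrib[of "\<lambda>t. _ * t"] cong: if_cong)
      also have "(\<Sum>k<card X. edge_vec e (from_nat_into X k) * edge_vec f (from_nat_into X k)) =
          (\<Sum>v\<in>X. edge_vec e v * edge_vec f v)"
        using bij_betw_from_nat_into_finite[OF X(1)]
        by (rule sum.reindex_bij_betw)
      \<comment> \<open>Vertices outside \<open>V\<close> drop out because every edge of
        \<open>A\<close> lies in \<open>V\<close>.\<close>
      also have "\<dots> = (\<Sum>v\<in>V. edge_vec e v * edge_vec f v)"
        using X that A
        by (intro sum.mono_neutral_right)
          (auto simp: finite_simple_graph_def intro!: edge_vec_eq_0)
      finally show ?thesis by (simp add: field_simps)
    qed
    have "Matrix.mat (length es) (length es) (\<lambda>(i, j). of_bool (i = j) +
        \<beta> * (edge_col X (es ! i) \<bullet> (?R *\<^sub>v edge_col X (es ! j)))) = G"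
      unfolding G_def by (rule cong_mat) (simp_all only: prod.case q es(1)[symmetric] nth_mem)
    then have "Determinant.det (Q_set \<alpha> \<beta> X A) = Determinant.det (Q_set \<alpha> \<beta> X {}) * Determinant.det G"
      using det_Q_set_Un[OF finite.emptyI es(2) Int_empty_right R] unfolding es(1) Un_empty_left
      by (simp only:)
    then show ?thesis
      using X by (simp add: Q_set_empty)
  qed
  have "finite V"
    using V finite_subset by blast
  then show ?thesis
    using V by (simp add: det_eq)
qed

lemma adj_weight_eq:
  assumes "finite V" "\<alpha> > 0" "\<beta> \<ge> 0" "finite E"
  shows "adj_weight \<alpha> \<beta> V E a = 1 / sqrt (Determinant.det (Q_set \<alpha> \<beta> V {e\<in>E. a e}))"
proof -
  let ?Q = "Q_set \<alpha> \<beta> V {e\<in>E. a e}"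
  have pos: "Determinant.det ?Q > 0"
    using assms by (intro det_Q_set_pos) auto
  obtain R where R: "R \<in> carrier_mat (card V) (card V)" "?Q * R = 1\<^sub>m (card V)"
      "mat_inverse ?Q = Some R"
    using right_inverse_exists[OF Q_set_carrier less_imp_neq[OF pos, symmetric]] by blast
  have "Determinant.det ?Q * Determinant.det R = 1"
    using det_mult[OF Q_set_carrier R(1), of \<alpha> \<beta> "{e\<in>E. a e}"] R(2) by simp
  then have "Determinant.det R = 1 / Determinant.det ?Q"
    using pos by (simp add: field_simps)
  then show ?thesis
    using assms R(3) by (simp add: adj_weight_def Sigma_mat_def Q_mat_eq_Q_set real_sqrt_divide)
qed

section \<open>Log-supermodular weights\<close>

text \<open>Diminishing returns in multiplicative form: the ratio
  \<open>d (insert e A) / d A\<close> can only fall as \<open>A\<close> grows. The elements of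
  \<open>B - A\<close> are added singly, each by one use of \<open>local\<close>.\<close>

lemma submodular_marginal_antimono:
  fixes d :: "'a set \<Rightarrow> real"
  assumes fin: "finite E" and pos: "\<And>A. A \<subseteq> E \<Longrightarrow> d A > 0"
    and local: "\<And>A e f. A \<subseteq> E \<Longrightarrow> e \<in> E - A \<Longrightarrow> f \<in> E - A \<Longrightarrow> e \<noteq> f \<Longrightarrow>
      d (insert e (insert f A)) * d A \<le> d (insert e A) * d (insert f A)"
    and A: "A \<subseteq> B" "B \<subseteq> E" and e: "e \<in> E - B"
  shows "d (insert e B) * d A \<le> d (insert e A) * d B"
proof -
  have "finite (B - A)" using A fin by (metis finite_Diff finite_subset)
  moreover have "d (insert e (A \<union> C)) * d A \<le> d (insert e A) * d (A \<union> C)"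
    if "C \<subseteq> B - A" "finite C" for C
    using that(2,1)
  proof (induction C rule: finite_induct)
    case (insert f C)
    let ?X = "A \<union> C"
    have X: "?X \<subseteq> E" "e \<in> E - ?X" "f \<in> E - ?X" "e \<noteq> f" "insert f ?X \<subseteq> E"
      using insert A e by auto
    \<comment> \<open>The extra factor \<open>d ?X\<close> lets the local inequality and the
      induction hypothesis be chained without division; positivity cancels it afterwards.\<close>
    have "d (insert e (insert f ?X)) * d A * d ?X \<le> (d (insert e ?X) * d (insert f ?X)) * d A"
      using mult_right_mono[OF local[OF X(1-4)] less_imp_le[OF pos[of A]]] A by (simp only: mult_ac)
    also have "\<dots> = (d (insert e ?X) * d A) * d (insert f ?X)"
      by simp
    also have "\<dots> \<le> (d (insert e A) * d ?X) * d (insert f ?X)"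
      using insert pos[OF X(5)] by (intro mult_right_mono) auto
    finally have "(d (insert e (insert f ?X)) * d A) * d ?X \<le> (d (insert e A) * d (insert f ?X)) * d ?X"
      by (simp add: mult_ac)
    then have "d (insert e (insert f ?X)) * d A \<le> d (insert e A) * d (insert f ?X)"
      using pos[OF X(1)] by simp
    then show ?case by simp
  qed simp
  ultimately have "d (insert e (A \<union> (B - A))) * d A \<le> d (insert e A) * d (A \<union> (B - A))"
    by blast
  moreover have "A \<union> (B - A) = B" using A by blast
  ultimately show ?thesis by simp
qed

text \<open>\<open>B - A\<close> is built up simultaneously over \<open>A\<close> and over
  \<open>A \<inter> B\<close>. Each new element multiplies \<open>d\<close> by a ratio that is no
  larger over the larger set, so the inequality, an equality at the start, persists.\<close>

lemma submodular_if_local: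
  fixes d :: "'a set \<Rightarrow> real"
  assumes fin: "finite E" and pos: "\<And>A. A \<subseteq> E \<Longrightarrow> d A > 0"
    and local: "\<And>A e f. A \<subseteq> E \<Longrightarrow> e \<in> E - A \<Longrightarrow> f \<in> E - A \<Longrightarrow> e \<noteq> f \<Longrightarrow>
      d (insert e (insert f A)) * d A \<le> d (insert e A) * d (insert f A)"
    and AB: "A \<subseteq> E" "B \<subseteq> E"
  shows "d (A \<union> B) * d (A \<inter> B) \<le> d A * d B"
proof -
  have "finite (B - A)" using AB fin by (metis finite_Diff finite_subset)
  moreover have "d (A \<union> D) * d (A \<inter> B) \<le> d A * d ((A \<inter> B) \<union> D)" if "D \<subseteq> B - A" "finite D" for D
    using that(2,1)
  proof (induction D rule: finite_induct)
    case (insert e D)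
    let ?X = "(A \<inter> B) \<union> D" let ?Y = "A \<union> D"
    have XY: "?X \<subseteq> ?Y" "?Y \<subseteq> E" "e \<in> E - ?Y"
      using insert AB by auto
    then have X: "?X \<subseteq> E" "insert e ?X \<subseteq> E" "insert e ?Y \<subseteq> E" by auto
    have "d (insert e ?Y) * d (A \<inter> B) * (d ?X * d ?Y) =
        (d (insert e ?Y) * d ?X) * (d ?Y * d (A \<inter> B))"
      by simp
    also have "\<dots> \<le> (d (insert e ?X) * d ?Y) * (d A * d ?X)"
    proof (rule mult_mono)
      show "d (insert e ?Y) * d ?X \<le> d (insert e ?X) * d ?Y"
        by (rule submodular_marginal_antimono[of E d, OF fin pos local XY])
      show "d ?Y * d (A \<inter> B) \<le> d A * d ?X"
        using insert by auto
      show "0 \<le> d (insert e ?X) * d ?Y" "0 \<le> d ?Y * d (A \<inter> B)"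
        using X XY AB by (intro mult_nonneg_nonneg less_imp_le[OF pos]; auto)+
    qed
    also have "\<dots> = (d A * d (insert e ?X)) * (d ?X * d ?Y)"
      by simp
    finally have "d (insert e ?Y) * d (A \<inter> B) \<le> d A * d (insert e ?X)"
      using pos[OF X(1)] pos[OF XY(2)] by simp
    then show ?case by simp
  qed simp
  ultimately have "d (A \<union> (B - A)) * d (A \<inter> B) \<le> d A * d ((A \<inter> B) \<union> (B - A))"
    by blast
  moreover have "A \<union> (B - A) = A \<union> B" "(A \<inter> B) \<union> (B - A) = B" by blast+
  ultimately show ?thesis by simp
qed

section \<open>The four functions theorem and its consequence for restricted weights\<close>

lemma four_functions_numeric:
  fixes a b c d a' b' c' d' :: real
  assumes "0 \<le> a" "0 \<le> b" "0 \<le> c" "0 \<le> d" "0 \<le> a'" "0 \<le> b'" "0 \<le> c'" "0 \<le> d'"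
    and 1: "a * b \<le> c * d" and 2: "a * b' \<le> c' * d" and 3: "a' * b \<le> c' * d" and 4: "a' * b' \<le> c' * d'"
  shows "(a + a') * (b + b') \<le> (c + c') * (d + d')"
proof -
  \<comment> \<open>Unprimed letters are values at the empty set, primed ones at a singleton.
    Nothing bounds a cross term by \<open>c * d'\<close> alone, so the two are treated together:
    \<open>?P\<close> and \<open>?R\<close> are at most \<open>?X\<close>, and
    \<open>?P * ?R\<close> is at most \<open>?X * (c * d')\<close>. Expanding
    \<open>(?X - ?P) * (?X - ?R) \<ge> 0\<close> and dividing by \<open>?X\<close> gives the
    bound.\<close>
  let ?X = "c' * d" and ?P = "a * b'" and ?R = "a' * b"
  have "?P + ?R \<le> ?X + c * d'"
  proof (cases "?X = 0")
    case True
    then have "?P + ?R \<le> 0"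
      using 2 3 by linarith
    also have "\<dots> \<le> ?X + c * d'"
      using assms(1-8) by (intro add_nonneg_nonneg mult_nonneg_nonneg)
    finally show ?thesis .
  next
    case False
    then have X: "?X > 0"
      using assms(1-8) by (metis less_eq_real_def mult_nonneg_nonneg)
    have "?P * ?R = (a * b) * (a' * b')" by simp
    also have "\<dots> \<le> (c * d) * (c' * d')"
      using assms(1-8) by (intro mult_mono[OF 1 4] mult_nonneg_nonneg)
    also have "\<dots> = ?X * (c * d')" by simp
    finally have "?P * ?R \<le> ?X * (c * d')" .
    moreover have "0 \<le> (?X - ?P) * (?X - ?R)"
      using 2 3 by simp
    ultimately have "?X * (?P + ?R) \<le> ?X * (?X + c * d')"
      by (simp add: algebra_simps)
    then show ?thesis using X by (simp only: mult_le_cancel_left_pos)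
  qed
  with 1 4 show ?thesis by (simp add: algebra_simps)
qed

lemma sum_Pow_insert:
  assumes "finite E" "e \<notin> E"
  shows "(\<Sum>A\<in>Pow (insert e E). f A) = (\<Sum>A\<in>Pow E. f A + f (insert e A) :: real)"
proof -
  have "(\<Sum>A\<in>Pow (insert e E). f A) = (\<Sum>A\<in>Pow E. f A) + (\<Sum>A\<in>insert e ` Pow E. f A)"
    unfolding Pow_insert using assms by (intro sum.union_disjoint) auto
  also have "(\<Sum>A\<in>insert e ` Pow E. f A) = (\<Sum>A\<in>Pow E. f (insert e A))"
    using assms by (subst sum.reindex) (auto simp: inj_on_def)
  finally show ?thesis by (simp add: sum.distrib)
qed

lemma ahlswede_daykin_four_functions:
  fixes f1 f2 f3 f4 :: "'a set \<Rightarrow> real"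
  assumes "finite E"
    and "\<And>A. A \<subseteq> E \<Longrightarrow> 0 \<le> f1 A" "\<And>A. A \<subseteq> E \<Longrightarrow> 0 \<le> f2 A"
    and "\<And>A. A \<subseteq> E \<Longrightarrow> 0 \<le> f3 A" "\<And>A. A \<subseteq> E \<Longrightarrow> 0 \<le> f4 A"
    and "\<And>A B. A \<subseteq> E \<Longrightarrow> B \<subseteq> E \<Longrightarrow> f1 A * f2 B \<le> f3 (A \<union> B) * f4 (A \<inter> B)"
  shows "(\<Sum>A\<in>Pow E. f1 A) * (\<Sum>A\<in>Pow E. f2 A) \<le> (\<Sum>A\<in>Pow E. f3 A) * (\<Sum>A\<in>Pow E. f4 A)"
  using assms
proof (induction E arbitrary: f1 f2 f3 f4 rule: finite_induct)
  case (insert e E)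
  note nonneg = insert.prems(1-4) and le = insert.prems(5)
  \<comment> \<open>The induction hypothesis is used for the four functions with \<open>e\<close>
    summed out, \<open>f A + f (insert e A)\<close>. Their pointwise inequality is the numeric
    lemma.\<close>
  show ?case
    unfolding sum_Pow_insert[OF insert.hyps]
  proof (rule insert.IH)
    fix A B assume AB: "A \<subseteq> E" "B \<subseteq> E"
    then have e: "e \<notin> A" "e \<notin> B" using insert.hyps by auto
    have sub: "A \<subseteq> insert e E" "B \<subseteq> insert e E" "insert e A \<subseteq> insert e E" "insert e B \<subseteq> insert e E"
      "A \<union> B \<subseteq> insert e E" "insert e (A \<union> B) \<subseteq> insert e E"
      "A \<inter> B \<subseteq> insert e E" "insert e (A \<inter> B) \<subseteq> insert e E" using AB by auto
    show "(f1 A + f1 (insert e A)) * (f2 B + f2 (insert e B)) \<le>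
      (f3 (A \<union> B) + f3 (insert e (A \<union> B))) * (f4 (A \<inter> B) + f4 (insert e (A \<inter> B)))"
      using le[OF sub(1) sub(2)] le[OF sub(1) sub(4)] le[OF sub(3) sub(2)] le[OF sub(3) sub(4)] e
      by (intro four_functions_numeric nonneg sub) auto
  qed (auto intro!: add_nonneg_nonneg nonneg)
qed auto

text \<open>The four functions are
  \<open>w 1[S \<subseteq> A \<subseteq> F]\<close>, \<open>w\<close>, \<open>w 1[S \<subseteq> A]\<close> and \<open>w 1[A \<subseteq> F]\<close>.\<close>
lemma log_supermodular_restrict:
  fixes w :: "'a set \<Rightarrow> real"
  assumes fin: "finite E" and "F \<subseteq> E" and pos: "\<And>A. A \<subseteq> E \<Longrightarrow> w A > 0"
    and super: "\<And>A B. A \<subseteq> E \<Longrightarrow> B \<subseteq> E \<Longrightarrow> w A * w B \<le> w (A \<union> B) * w (A \<inter> B)"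
  shows "(\<Sum>A | A \<subseteq> F \<and> S \<subseteq> A. w A) / (\<Sum>A\<in>Pow F. w A) \<le>
    (\<Sum>A | A \<subseteq> E \<and> S \<subseteq> A. w A) / (\<Sum>A\<in>Pow E. w A)"
proof -
  have "(\<Sum>A\<in>Pow E. if S \<subseteq> A \<and> A \<subseteq> F then w A else 0) * (\<Sum>A\<in>Pow E. w A) \<le>
    (\<Sum>A\<in>Pow E. if S \<subseteq> A then w A else 0) * (\<Sum>A\<in>Pow E. if A \<subseteq> F then w A else 0)"
  proof (rule ahlswede_daykin_four_functions[OF fin])
    fix A B assume AB: "A \<subseteq> E" "B \<subseteq> E"
    have "0 < w (A \<union> B)" "0 < w (A \<inter> B)"
      using AB by (auto intro!: pos)
    \<comment> \<open>\<open>S \<subseteq> A\<close> passes up to \<open>A \<union> B\<close> and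
      \<open>A \<subseteq> F\<close> down to \<open>A \<inter> B\<close>, so a nonzero left side
      forces both conditions on the right.\<close>
    then show "(if S \<subseteq> A \<and> A \<subseteq> F then w A else 0) * w B \<le>
        (if S \<subseteq> A \<union> B then w (A \<union> B) else 0) * (if A \<inter> B \<subseteq> F then w (A \<inter> B) else 0)"
      using super[OF AB] by auto
  qed (auto simp: less_imp_le pos)
  moreover have "(\<Sum>A\<in>Pow E. if S \<subseteq> A \<and> A \<subseteq> F then w A else 0) = (\<Sum>A | A \<subseteq> F \<and> S \<subseteq> A. w A)"
    using fin \<open>F \<subseteq> E\<close> by (subst sum.inter_filter[symmetric]) (auto intro!: sum.cong)
  moreover have "(\<Sum>A\<in>Pow E. if S \<subseteq> A then w A else 0) = (\<Sum>A | A \<subseteq> E \<and> S \<subseteq> A. w A)"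
    using fin by (subst sum.inter_filter[symmetric]) (auto intro!: sum.cong)
  moreover have "(\<Sum>A\<in>Pow E. if A \<subseteq> F then w A else 0) = (\<Sum>A\<in>Pow F. w A)"
    using fin \<open>F \<subseteq> E\<close> by (subst sum.inter_filter[symmetric]) (auto intro!: sum.cong)
  moreover have "(\<Sum>A\<in>Pow E. w A) > 0" "(\<Sum>A\<in>Pow F. w A) > 0"
    using fin \<open>F \<subseteq> E\<close> finite_subset[OF \<open>F \<subseteq> E\<close> fin] by (auto intro!: sum_pos pos)
  ultimately show ?thesis
    by (simp add: field_simps)
qed

section \<open>Weak limits of random configurations\<close>

lemma space_config_space: "space (config_space I) = I \<rightarrow>\<^sub>E UNIV"
  by (simp add: config_space_def space_PiM)

lemma topspace_config_topology: "topspace (config_topology I) = I \<rightarrow>\<^sub>E UNIV"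
  by (simp add: config_topology_def)

lemma compact_space_config_topology: "compact_space (config_topology I)"
  unfolding config_topology_def compact_space_product_topology
  by (simp add: compact_space_discrete_topology)

text \<open>For \<open>p\<close> in \<open>Pow J\<close> these are the atoms of the events depending
  on \<open>J\<close>. In particular, \<open>pattern I S S\<close> is the event that all edges of
  \<open>S\<close> are present.\<close>

definition pattern :: "'v set set \<Rightarrow> 'v set set \<Rightarrow> 'v set set \<Rightarrow> ('v set \<Rightarrow> bool) set" where
  "pattern I J p = {x \<in> I \<rightarrow>\<^sub>E UNIV. \<forall>j\<in>J. x j \<longleftrightarrow> j \<in> p}"

definition determined_by :: "'v set set \<Rightarrow> 'v set set \<Rightarrow> ('v set \<Rightarrow> bool) set \<Rightarrow> bool" where
  "determined_by I J B \<longleftrightarrow> B \<subseteq> I \<rightarrow>\<^sub>E UNIV \<and>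
     (\<forall>x\<in>B. \<forall>y\<in>I \<rightarrow>\<^sub>E UNIV. (\<forall>j\<in>J. x j = y j) \<longrightarrow> y \<in> B)"

definition cylinder_events :: "'v set set \<Rightarrow> ('v set \<Rightarrow> bool) set set" where
  "cylinder_events I = {B. \<exists>J. finite J \<and> J \<subseteq> I \<and> determined_by I J B}"

lemma cylinder_eventsI:
  assumes "finite J" "J \<subseteq> I" "determined_by I J B"
  shows "B \<in> cylinder_events I"
  using assms by (auto simp: cylinder_events_def)

text \<open>This reduces measurability, openness and convergence of probabilities to single atoms;
  \<open>P\<close> is finite because \<open>J\<close> is.\<close>

lemma cylinder_event_eq_UN_pattern:
  assumes "B \<in> cylinder_events I"
  obtains J P where "finite J" "J \<subseteq> I" "P \<subseteq> Pow J" "B = (\<Union>p\<in>P. pattern I J p)"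
proof -
  obtain J where J: "finite J" "J \<subseteq> I" and det: "determined_by I J B"
    using assms by (auto simp: cylinder_events_def)
  then have B: "B \<subseteq> I \<rightarrow>\<^sub>E UNIV"
    by (simp add: determined_by_def)
  let ?P = "{p \<in> Pow J. pattern I J p \<subseteq> B}"
  have "B \<subseteq> (\<Union>p\<in>?P. pattern I J p)"
  proof
    fix x assume x: "x \<in> B"
    let ?p = "{j\<in>J. x j}"
    have "pattern I J ?p \<subseteq> B"
    proof
      fix y assume "y \<in> pattern I J ?p"
      then have "y \<in> I \<rightarrow>\<^sub>E UNIV" "\<forall>j\<in>J. x j = y j"
        by (auto simp: pattern_def)
      then show "y \<in> B"
        using det x unfolding determined_by_def by blast
    qed
    moreover have "x \<in> pattern I J ?p"
      using x B by (auto simp: pattern_def)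
    moreover have "?p \<in> Pow J" by simp
    ultimately show "x \<in> (\<Union>p\<in>?P. pattern I J p)"
      by (intro UN_I[of ?p] CollectI conjI)
  qed
  then have "B = (\<Union>p\<in>?P. pattern I J p)" by blast
  from that[OF J _ this] show ?thesis by blast
qed

lemma disjoint_family_pattern: "disjoint_family_on (pattern I J) (Pow J)"
  by (auto simp: disjoint_family_on_def pattern_def)

lemma pattern_in_cylinder_events:
  assumes "finite J" "J \<subseteq> I"
  shows "pattern I J p \<in> cylinder_events I"
  by (rule cylinder_eventsI[OF assms]) (auto simp: pattern_def determined_by_def)

lemma sets_pattern:
  assumes "finite J" "J \<subseteq> I"
  shows "pattern I J p \<in> sets (config_space I)"
proof -
  have "pattern I J p = prod_emb I (\<lambda>_. count_space UNIV) J (\<Pi>\<^sub>E j\<in>J. {j \<in> p})"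
    using assms by (auto simp: pattern_def prod_emb_def space_PiM PiE_iff extensional_arb[of _ I])
  also have "\<dots> \<in> sets (config_space I)"
    unfolding config_space_def using assms by (intro sets_PiM_I) auto
  finally show ?thesis .
qed

lemma openin_pattern:
  assumes "finite J" "J \<subseteq> I"
  shows "openin (config_topology I) (pattern I J p)"
proof -
  have "pattern I J p = (\<Pi>\<^sub>E i\<in>I. if i \<in> J then {i \<in> p} else UNIV)"
    using assms by (auto simp: pattern_def PiE_iff extensional_arb[of _ I] split: if_splits)
  also have "openin (config_topology I) \<dots>"
    unfolding config_topology_def openin_PiE_gen
    using assms by (auto intro!: finite_subset[OF _ assms(1)] split: if_splits)
  finally show ?thesis .
qed

lemma openin_cylinder_event:
  assumes "B \<in> cylinder_events I"
  shows "openin (config_topology I) B"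
  using assms by (elim cylinder_event_eq_UN_pattern) (auto intro!: openin_pattern)

lemma sets_cylinder_event:
  assumes "B \<in> cylinder_events I"
  shows "B \<in> sets (config_space I)"
proof -
  obtain J P where JP: "finite J" "J \<subseteq> I" "P \<subseteq> Pow J" "B = (\<Union>p\<in>P. pattern I J p)"
    using assms by (rule cylinder_event_eq_UN_pattern)
  have "finite P"
    using finite_subset[OF JP(3)] JP(1) by simp
  then show ?thesis
    using JP by (auto intro!: sets_pattern)
qed

lemma algebra_cylinder_events: "Sigma_Algebra.algebra (I \<rightarrow>\<^sub>E UNIV) (cylinder_events I)"
  unfolding algebra_iff_Int
proof (intro conjI ballI)
  show "cylinder_events I \<subseteq> Pow (I \<rightarrow>\<^sub>E UNIV)"
    by (auto simp: cylinder_events_def determined_by_def)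
  show "{} \<in> cylinder_events I"
    by (rule cylinder_eventsI[of "{}"]) (auto simp: determined_by_def)
next
  fix A assume "A \<in> cylinder_events I"
  then obtain J where J: "finite J" "J \<subseteq> I" and A: "determined_by I J A"
    by (auto simp: cylinder_events_def)
  have "determined_by I J ((I \<rightarrow>\<^sub>E UNIV) - A)"
    unfolding determined_by_def
  proof (intro conjI ballI impI)
    fix x y assume "x \<in> (I \<rightarrow>\<^sub>E UNIV) - A" "y \<in> I \<rightarrow>\<^sub>E UNIV" "\<forall>j\<in>J. x j = y j"
    moreover from this have "\<forall>j\<in>J. y j = x j" by simp
    ultimately show "y \<in> (I \<rightarrow>\<^sub>E UNIV) - A"
      using A unfolding determined_by_def by blast
  qed blast
  with J show "(I \<rightarrow>\<^sub>E UNIV) - A \<in> cylinder_events I"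
    by (rule cylinder_eventsI)
next
  fix A B assume "A \<in> cylinder_events I" "B \<in> cylinder_events I"
  then obtain J K where JK: "finite J" "J \<subseteq> I" "finite K" "K \<subseteq> I"
    and A: "determined_by I J A" and B: "determined_by I K B"
    by (auto simp: cylinder_events_def)
  have "determined_by I (J \<union> K) (A \<inter> B)"
    unfolding determined_by_def
  proof (intro conjI ballI impI)
    show "A \<inter> B \<subseteq> I \<rightarrow>\<^sub>E UNIV"
      using A by (auto simp: determined_by_def)
    fix x y assume "x \<in> A \<inter> B" "y \<in> I \<rightarrow>\<^sub>E UNIV" and eq: "\<forall>j\<in>J \<union> K. x j = y j"
    moreover from eq have "\<forall>j\<in>J. x j = y j" "\<forall>j\<in>K. x j = y j" by simp_all
    ultimately show "y \<in> A \<inter> B"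
      using A B unfolding determined_by_def by blast
  qed
  with JK show "A \<inter> B \<in> cylinder_events I"
    by (intro cylinder_eventsI[of "J \<union> K"]) auto
qed

lemma sets_config_space_eq_sigma_cylinder_events:
  "sets (config_space I) = sigma_sets (I \<rightarrow>\<^sub>E UNIV) (cylinder_events I)"
proof (rule antisym)
  have "{f \<in> I \<rightarrow>\<^sub>E UNIV. f i \<in> A} \<in> cylinder_events I" if "i \<in> I" for i A
    using that by (intro cylinder_eventsI[of "{i}"]) (auto simp: determined_by_def)
  then show "sets (config_space I) \<subseteq> sigma_sets (I \<rightarrow>\<^sub>E UNIV) (cylinder_events I)"
    unfolding config_space_def sets_PiM_single space_count_space
    by (intro sigma_sets_mono') auto
  show "sigma_sets (I \<rightarrow>\<^sub>E UNIV) (cylinder_events I) \<subseteq> sets (config_space I)"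
    using sets_cylinder_event unfolding space_config_space[symmetric]
    by (intro sets.sigma_sets_subset) auto
qed

text \<open>Closedness holds because the complement is again a cylinder event, hence open. The
  conclusion is stronger than continuity at the empty set: the sequence is eventually empty.\<close>

lemma decseq_cylinder_events_empty:
  assumes C: "range C \<subseteq> cylinder_events I" and "decseq C" and "(\<Inter>i. C i) = {}"
  shows "\<exists>i. C i = {}"
proof (rule ccontr)
  assume ne: "\<nexists>i. C i = {}"
  interpret Sigma_Algebra.algebra "I \<rightarrow>\<^sub>E UNIV" "cylinder_events I"
    by (rule algebra_cylinder_events)
  have "closedin (config_topology I) (C i)" for i
  proof -
    have "C i \<in> cylinder_events I" using C by blast
    then show ?thesis
      using sets_into_space openin_cylinder_event[OF compl_sets]
      by (auto simp: closedin_def topspace_config_topology)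
  qed
  then have "(\<Inter>i. C i) \<noteq> {}"
    using ne \<open>decseq C\<close>
    by (intro compact_space_imp_nest[OF compact_space_config_topology]) auto
  with assms(3) show False by simp
qed


section \<open>Construction of the limit measure\<close>

lemma convergent_cylinder_event:
  assumes prob: "\<And>n. prob_space (M n)" and sets: "\<And>n. sets (M n) = sets (config_space I)"
    and conv: "\<And>S. finite S \<Longrightarrow> S \<subseteq> I \<Longrightarrow> convergent (\<lambda>n. measure (M n) (pattern I S S))"
    and B: "B \<in> cylinder_events I"
  shows "convergent (\<lambda>n. measure (M n) B)"
proof -
  interpret M: prob_space "M n" for n by (rule prob)
  have conv_pattern: "convergent (\<lambda>n. measure (M n) (pattern I (S \<union> T) S))"
    if "finite T" "finite S" "S \<inter> T = {}" "S \<union> T \<subseteq> I" for S T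
    using that
  \<comment> \<open>Inclusion-exclusion one absent edge at a time: the probability with
    \<open>t\<close> absent is the one without a condition on \<open>t\<close> minus the one with
    \<open>t\<close> present. The last term moves \<open>t\<close> into \<open>S\<close>, so
    \<open>S\<close> must vary in the induction.\<close>
  proof (induction T arbitrary: S rule: finite_induct)
    case (insert t T)
    have "measure (M n) (pattern I (S \<union> T) S) = measure (M n) (pattern I (S \<union> insert t T) S) +
        measure (M n) (pattern I (insert t S \<union> T) (insert t S))" for n
    proof -
      have t: "t \<notin> S" "t \<notin> T" using insert.hyps insert.prems by auto
      have "pattern I (S \<union> T) S =
          pattern I (S \<union> insert t T) S \<union> pattern I (insert t S \<union> T) (insert t S)"
        using t by (auto simp: pattern_def)
      moreover have "pattern I (S \<union> insert t T) S \<inter> pattern I (insert t S \<union> T) (insert t S) = {}"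
        using t by (auto simp: pattern_def)
      ultimately show ?thesis
        using insert.hyps insert.prems by (simp add: M.finite_measure_Union sets sets_pattern)
    qed
    then have "measure (M n) (pattern I (S \<union> insert t T) S) = measure (M n) (pattern I (S \<union> T) S) -
        measure (M n) (pattern I (insert t S \<union> T) (insert t S))" for n
      by (simp add: algebra_simps)
    moreover have "convergent (\<lambda>n. measure (M n) (pattern I (S \<union> T) S))"
      using insert by (intro insert.IH) auto
    moreover have "convergent (\<lambda>n. measure (M n) (pattern I (insert t S \<union> T) (insert t S)))"
      using insert by (intro insert.IH) auto
    ultimately show ?case
      by (simp only: convergent_diff)
  qed (simp add: conv)
  obtain J P where JP: "finite J" "J \<subseteq> I" "P \<subseteq> Pow J" and B_eq: "B = (\<Union>p\<in>P. pattern I J p)"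
    using B by (rule cylinder_event_eq_UN_pattern)
  have fin: "finite P"
    using finite_subset[OF JP(3)] JP(1) by simp
  have "measure (M n) B = (\<Sum>p\<in>P. measure (M n) (pattern I J p))" for n
    unfolding B_eq using fin JP
    by (intro M.finite_measure_finite_Union disjoint_family_on_mono[OF _ disjoint_family_pattern])
      (auto simp: sets sets_pattern)
  moreover have "convergent (\<lambda>n. measure (M n) (pattern I J p))" if "p \<in> P" for p
  proof -
    have "p \<subseteq> J" using that JP by blast
    moreover from this have "p \<union> (J - p) = J" by blast
    ultimately show ?thesis
      using conv_pattern[of "J - p" p] JP finite_subset[of p J] by auto
  qed
  ultimately show ?thesis
    by (simp add: convergent_sum)
qed

text \<open>Pointwise limits preserve only finite additivity. Countable additivity comes from
  \<open>decseq_cylinder_events_empty\<close> through Caratheodory's extension theorem.\<close>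

lemma ex_measure_eq_lim_cylinder_events:
  assumes prob: "\<And>n. prob_space (M n)" and sets: "\<And>n. sets (M n) = sets (config_space I)"
    and conv: "\<And>B. B \<in> cylinder_events I \<Longrightarrow> convergent (\<lambda>n. measure (M n) B)"
  obtains \<nu> where "prob_space \<nu>" "sets \<nu> = sets (config_space I)"
    "\<And>B. B \<in> cylinder_events I \<Longrightarrow> (\<lambda>n. measure (M n) B) \<longlonglongrightarrow> measure \<nu> B"
proof -
  let ?\<Omega> = "I \<rightarrow>\<^sub>E UNIV :: ('a set \<Rightarrow> bool) set" and ?C = "cylinder_events I"
  interpret M: prob_space "M n" for n by (rule prob)
  interpret C: Sigma_Algebra.algebra ?\<Omega> ?C by (rule algebra_cylinder_events)
  define L where "L B = lim (\<lambda>n. measure (M n) B)" for B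
  have L: "(\<lambda>n. measure (M n) B) \<longlonglongrightarrow> L B" if "B \<in> ?C" for B
    using conv[OF that] by (simp add: L_def convergent_LIMSEQ_iff)
  have L_nonneg: "L B \<ge> 0" if "B \<in> ?C" for B
    using L[OF that] by (rule LIMSEQ_le_const) simp
  have L_add: "L (A \<union> B) = L A + L B" if "A \<in> ?C" "B \<in> ?C" "A \<inter> B = {}" for A B
  proof (rule LIMSEQ_unique)
    show "(\<lambda>n. measure (M n) (A \<union> B)) \<longlonglongrightarrow> L (A \<union> B)"
      using that by (intro L C.Un)
    show "(\<lambda>n. measure (M n) (A \<union> B)) \<longlonglongrightarrow> L A + L B"
      using tendsto_add[OF L[OF that(1)] L[OF that(2)]] that
      by (simp add: M.finite_measure_Union sets sets_cylinder_event)
  qed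
  have "measure (M n) ?\<Omega> = 1" for n
    using M.prob_space sets_eq_imp_space_eq[OF sets] by (simp add: space_config_space)
  then have L_space: "L ?\<Omega> = 1"
    using L[OF C.top] by (simp add: LIMSEQ_const_iff)
  have L_empty: "L {} = 0"
    by (simp add: L_def)
  have "\<exists>\<mu>. (\<forall>B\<in>?C. \<mu> B = ennreal (L B)) \<and> measure_space ?\<Omega> (sigma_sets ?\<Omega> ?C) \<mu>"
  proof (rule C.caratheodory_empty_continuous)
    show "positive ?C (\<lambda>B. ennreal (L B))"
      by (simp add: positive_def L_empty)
    show "additive ?C (\<lambda>B. ennreal (L B))"
      by (auto simp: additive_def L_add L_nonneg)
    fix A :: "nat \<Rightarrow> ('a set \<Rightarrow> bool) set" assume A: "range A \<subseteq> ?C" "decseq A" "(\<Inter>i. A i) = {}"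
    then obtain i where "A i = {}"
      using decseq_cylinder_events_empty by blast
    then have "A j = {}" if "j \<ge> i" for j
      using A(2) that by (auto simp: decseq_def)
    then have "\<forall>\<^sub>F j in sequentially. ennreal (L (A j)) = 0"
      by (auto intro!: eventually_sequentiallyI[of i] simp: L_empty)
    then show "(\<lambda>j. ennreal (L (A j))) \<longlonglongrightarrow> 0"
      by (rule tendsto_eventually)
  qed simp
  then obtain \<mu> where \<mu>: "\<And>B. B \<in> ?C \<Longrightarrow> \<mu> B = ennreal (L B)"
    and ms: "measure_space ?\<Omega> (sigma_sets ?\<Omega> ?C) \<mu>" by blast
  \<comment> \<open>By \<open>ms\<close>, \<open>measure_of\<close> keeps the values of \<mu>
    instead of defaulting to the zero measure.\<close>
  define \<nu> where "\<nu> = measure_of ?\<Omega> (sigma_sets ?\<Omega> ?C) \<mu>"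
  have sets_\<nu>: "sets \<nu> = sigma_sets ?\<Omega> ?C" and space_\<nu>: "space \<nu> = ?\<Omega>"
    using ms by (auto simp: \<nu>_def measure_space_def sigma_algebra.sets_measure_of_eq
        sigma_algebra.space_measure_of_eq)
  have "emeasure \<nu> B = \<mu> B" if "B \<in> sigma_sets ?\<Omega> ?C" for B
    using ms that unfolding \<nu>_def measure_space_def by (intro emeasure_measure_of_sigma) auto
  then have em: "emeasure \<nu> B = ennreal (L B)" if "B \<in> ?C" for B
    using that \<mu> by auto
  show thesis
  proof (rule that)
    show "prob_space \<nu>"
      by (rule prob_spaceI) (simp add: space_\<nu> em C.top L_space)
    show "sets \<nu> = sets (config_space I)"
      by (simp add: sets_\<nu> sets_config_space_eq_sigma_cylinder_events)
    show "(\<lambda>n. measure (M n) B) \<longlonglongrightarrow> measure \<nu> B" if "B \<in> ?C" for B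
      using L[OF that] em[OF that] L_nonneg[OF that] by (simp add: measure_def)
  qed
qed

section \<open>Continuous functions and weak convergence\<close>

lemma extend_config_in_space: "extend_config F I x \<in> I \<rightarrow>\<^sub>E UNIV"
  by (simp add: extend_config_def)

text \<open>Here \<open>extend_config J I\<close> acts as a truncation that sets all coordinates
  outside \<open>J\<close> to 0. Compactness yields finitely many patterns covering the space on
  each of which \<open>f\<close> is nearly constant, and \<open>J\<close> collects their
  coordinates.\<close>

lemma continuous_map_config_uniform_approx:
  fixes f :: "('v set \<Rightarrow> bool) \<Rightarrow> real"
  assumes f: "continuous_map (config_topology I) euclidean f" and "\<epsilon> > 0"
  obtains J where "finite J" "J \<subseteq> I"
    "\<And>x. x \<in> I \<rightarrow>\<^sub>E UNIV \<Longrightarrow> \<bar>f x - f (extend_config J I x)\<bar> < \<epsilon>"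
proof -
  let ?\<Omega> = "I \<rightarrow>\<^sub>E UNIV :: ('v set \<Rightarrow> bool) set"
  have "\<exists>J. finite J \<and> J \<subseteq> I \<and> (\<forall>y\<in>pattern I J {i. x i}. \<bar>f y - f x\<bar> < \<epsilon> / 2)"
    if x: "x \<in> ?\<Omega>" for x
  proof -
    let ?W = "{y \<in> topspace (config_topology I). f y \<in> {f x - \<epsilon> / 2 <..< f x + \<epsilon> / 2}}"
    have "openin (config_topology I) ?W"
      by (rule openin_continuous_map_preimage[OF f]) simp
    moreover have "x \<in> ?W"
      using x \<open>\<epsilon> > 0\<close> by (simp add: topspace_config_topology)
    ultimately have "\<exists>U. finite {i \<in> I. U i \<noteq> topspace (discrete_topology UNIV)} \<and>
        (\<forall>i\<in>I. openin (discrete_topology UNIV) (U i)) \<and> x \<in> Pi\<^sub>E I U \<and> Pi\<^sub>E I U \<subseteq> ?W"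
      unfolding config_topology_def openin_product_topology_alt by (rule bspec)
    then obtain U where U: "finite {i \<in> I. U i \<noteq> UNIV}" "x \<in> Pi\<^sub>E I U" "Pi\<^sub>E I U \<subseteq> ?W"
      by auto
    have "pattern I {i \<in> I. U i \<noteq> UNIV} {i. x i} \<subseteq> Pi\<^sub>E I U"
    proof
      fix y assume y: "y \<in> pattern I {i \<in> I. U i \<noteq> UNIV} {i. x i}"
      have "y i \<in> U i" if "i \<in> I" for i
        using y U(2) that by (cases "U i = UNIV") (auto simp: pattern_def PiE_iff)
      with y show "y \<in> Pi\<^sub>E I U"
        by (auto simp: pattern_def PiE_iff)
    qed
    with U(3) have near: "f y \<in> {f x - \<epsilon> / 2 <..< f x + \<epsilon> / 2}" if "y \<in> pattern I {i \<in> I. U i \<noteq> UNIV} {i. x i}" for y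
      using that by blast
    have "\<bar>f y - f x\<bar> < \<epsilon> / 2" if "y \<in> pattern I {i \<in> I. U i \<noteq> UNIV} {i. x i}" for y
      using near[OF that] unfolding greaterThanLessThan_iff by linarith
    with U(1) show ?thesis
      by (intro exI[of _ "{i \<in> I. U i \<noteq> UNIV}"]) auto
  qed
  then obtain N where N: "\<And>x. x \<in> ?\<Omega> \<Longrightarrow> finite (N x)" "\<And>x. x \<in> ?\<Omega> \<Longrightarrow> N x \<subseteq> I"
    and close: "\<And>x y. x \<in> ?\<Omega> \<Longrightarrow> y \<in> pattern I (N x) {i. x i} \<Longrightarrow> \<bar>f y - f x\<bar> < \<epsilon> / 2"
    by metis
  have "\<exists>D. D \<subseteq> ?\<Omega> \<and> finite D \<and> ?\<Omega> \<subseteq> (\<Union>x\<in>D. pattern I (N x) {i. x i})"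
  proof -
    have "compactin (config_topology I) ?\<Omega>"
      using compact_space_config_topology by (simp add: compact_space_def topspace_config_topology)
    moreover have "openin (config_topology I) U" if "U \<in> (\<lambda>x. pattern I (N x) {i. x i}) ` ?\<Omega>" for U
      using that N by (auto intro!: openin_pattern)
    moreover have "?\<Omega> \<subseteq> \<Union>((\<lambda>x. pattern I (N x) {i. x i}) ` ?\<Omega>)"
      by (auto simp: pattern_def)
    ultimately obtain \<F> where \<F>: "finite \<F>" "\<F> \<subseteq> (\<lambda>x. pattern I (N x) {i. x i}) ` ?\<Omega>" "?\<Omega> \<subseteq> \<Union>\<F>"
      by (metis (no_types, lifting) compactinD)
    from finite_subset_image[OF \<F>(1,2)] obtain D where "D \<subseteq> ?\<Omega>" "finite D"
      "\<F> = (\<lambda>x. pattern I (N x) {i. x i}) ` D" by blast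
    with \<F>(3) show ?thesis by auto
  qed
  then obtain D where D: "D \<subseteq> ?\<Omega>" "finite D" and cover: "?\<Omega> \<subseteq> (\<Union>x\<in>D. pattern I (N x) {i. x i})"
    by blast
  show thesis
  proof (rule that)
    show "finite (\<Union>x\<in>D. N x)"
      using D N(1) by (intro finite_UN_I) auto
    show "(\<Union>x\<in>D. N x) \<subseteq> I"
      by (intro UN_least N(2) subsetD[OF D(1)])
    fix y assume "y \<in> ?\<Omega>"
    with cover obtain x where x: "x \<in> D" "y \<in> pattern I (N x) {i. x i}" by blast
    \<comment> \<open>Truncation keeps the coordinates in \<open>N x\<close>, so \<open>y\<close>
      and its truncation share the neighbourhood of \<open>x\<close>; each is within half of
      \<epsilon> of \<open>f x\<close>.\<close>
    then have "extend_config (\<Union>x\<in>D. N x) I y \<in> pattern I (N x) {i. x i}"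
      using N(2)[OF subsetD[OF D(1) x(1)]] by (auto simp: pattern_def extend_config_def)
    then have "\<bar>f (extend_config (\<Union>x\<in>D. N x) I y) - f x\<bar> < \<epsilon> / 2" "\<bar>f y - f x\<bar> < \<epsilon> / 2"
      using x(2) subsetD[OF D(1) x(1)] by (intro close; simp)+
    then show "\<bar>f y - f (extend_config (\<Union>x\<in>D. N x) I y)\<bar> < \<epsilon>"
      by linarith
  qed
qed

text \<open>Exactly one atom contains \<open>x\<close>, so the sum has a single nonzero indicator.
  This step function makes integrals finite sums of pattern probabilities.\<close>

lemma function_of_extend_config:
  fixes f :: "('v set \<Rightarrow> bool) \<Rightarrow> real"
  assumes "finite J" "J \<subseteq> I" "x \<in> I \<rightarrow>\<^sub>E UNIV"
  shows "f (extend_config J I x) =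
    (\<Sum>p\<in>Pow J. f (\<lambda>i\<in>I. i \<in> p) * indicator (pattern I J p) x)"
proof -
  let ?p = "{j\<in>J. x j}"
  have "(\<Sum>p\<in>Pow J. f (\<lambda>i\<in>I. i \<in> p) * indicator (pattern I J p) x) =
      (\<Sum>p\<in>Pow J. if p = ?p then f (\<lambda>i\<in>I. i \<in> p) else 0)"
    using assms by (intro sum.cong refl) (auto simp: pattern_def indicator_def)
  also have "\<dots> = f (\<lambda>i\<in>I. i \<in> ?p)"
    using assms by (subst sum.delta) auto
  also have "(\<lambda>i\<in>I. i \<in> ?p) = extend_config J I x"
    by (auto simp: extend_config_def)
  finally show ?thesis ..
qed

lemma
  fixes f :: "('v set \<Rightarrow> bool) \<Rightarrow> real"
  assumes "prob_space M" and sets: "sets M = sets (config_space I)" and J: "finite J" "J \<subseteq> I"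
  shows integrable_function_of_extend_config: "integrable M (\<lambda>x. f (extend_config J I x))"
    and integral_function_of_extend_config: "(\<integral>x. f (extend_config J I x) \<partial>M) =
      (\<Sum>p\<in>Pow J. f (\<lambda>i\<in>I. i \<in> p) * measure M (pattern I J p))"
proof -
  interpret prob_space M by fact
  have space: "space M = I \<rightarrow>\<^sub>E UNIV"
    using sets_eq_imp_space_eq[OF sets] by (simp add: space_config_space)
  have pat: "pattern I J p \<in> events" for p
    using J by (simp add: sets sets_pattern)
  let ?g = "\<lambda>x. \<Sum>p\<in>Pow J. f (\<lambda>i\<in>I. i \<in> p) * indicator (pattern I J p) x"
  have eq: "f (extend_config J I x) = ?g x" if "x \<in> space M" for x
    using that J unfolding space by (intro function_of_extend_config)
  have "integrable M ?g"
    using pat by (intro Bochner_Integration.integrable_sum integrable_mult_right)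
      (simp add: emeasure_eq_measure)
  then show "integrable M (\<lambda>x. f (extend_config J I x))"
    by (subst Bochner_Integration.integrable_cong[OF refl eq])
  have "(\<integral>x. f (extend_config J I x) \<partial>M) = (\<integral>x. ?g x \<partial>M)"
    by (rule Bochner_Integration.integral_cong[OF refl eq])
  also have "\<dots> = (\<Sum>p\<in>Pow J. f (\<lambda>i\<in>I. i \<in> p) * measure M (pattern I J p))"
    using pat by (subst Bochner_Integration.integral_sum)
      (auto intro!: integrable_mult_right simp: emeasure_eq_measure)
  finally show "(\<integral>x. f (extend_config J I x) \<partial>M) =
      (\<Sum>p\<in>Pow J. f (\<lambda>i\<in>I. i \<in> p) * measure M (pattern I J p))" .
qed

text \<open>For arbitrary \<open>I\<close> an open set may lie outside the product \<sigma>-field,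
  so continuity does not yield measurability directly. Instead \<open>f\<close> is a limit of
  functions of finitely many coordinates.\<close>

lemma integrable_continuous_config:
  fixes f :: "('v set \<Rightarrow> bool) \<Rightarrow> real"
  assumes "prob_space M" and sets: "sets M = sets (config_space I)"
    and f: "continuous_map (config_topology I) euclidean f" and bdd: "bounded (f ` topspace (config_topology I))"
  shows "integrable M f"
proof -
  interpret prob_space M by fact
  have space: "space M = I \<rightarrow>\<^sub>E UNIV"
    using sets_eq_imp_space_eq[OF sets] by (simp add: space_config_space)
  have "\<exists>J. finite J \<and> J \<subseteq> I \<and> (\<forall>x\<in>I \<rightarrow>\<^sub>E UNIV. \<bar>f x - f (extend_config J I x)\<bar> < 1 / Suc k)" for k
    using continuous_map_config_uniform_approx[OF f, of "1 / Suc k"] by (metis of_nat_0_less_iff zero_less_Suc zero_less_divide_1_iff)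
  then obtain J where J: "\<And>k. finite (J k)" "\<And>k. J k \<subseteq> I"
    and approx: "\<And>k x. x \<in> I \<rightarrow>\<^sub>E UNIV \<Longrightarrow> \<bar>f x - f (extend_config (J k) I x)\<bar> < 1 / Suc k"
    by metis
  have meas: "f \<in> borel_measurable M"
  proof (rule borel_measurable_LIMSEQ_real)
    show "(\<lambda>x. f (extend_config (J k) I x)) \<in> borel_measurable M" for k
      using integrable_function_of_extend_config[OF assms(1) sets J] by (rule borel_measurable_integrable)
    fix x assume "x \<in> space M"
    then have "norm (f (extend_config (J k) I x) - f x) \<le> 1 / Suc k" for k
      using approx[of x k] by (simp add: space abs_minus_commute less_imp_le)
    then show "(\<lambda>k. f (extend_config (J k) I x)) \<longlonglongrightarrow> f x"
      by (intro LIM_zero_cancel[OF Lim_null_comparison[OF always_eventually LIMSEQ_Suc[OF lim_1_over_n]]]) simp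
  qed
  obtain b where "\<And>x. x \<in> I \<rightarrow>\<^sub>E UNIV \<Longrightarrow> norm (f x) \<le> b"
    using bdd by (auto simp: bounded_iff topspace_config_topology)
  then show ?thesis
    using meas by (intro integrable_const_bound[of _ b]) (auto simp: space)
qed

lemma ex_weak_limit:
  fixes M :: "nat \<Rightarrow> ('v set \<Rightarrow> bool) measure"
  assumes prob: "\<And>n. prob_space (M n)" and sets: "\<And>n. sets (M n) = sets (config_space I)"
    and conv: "\<And>S. finite S \<Longrightarrow> S \<subseteq> I \<Longrightarrow> convergent (\<lambda>n. measure (M n) (pattern I S S))"
  shows "\<exists>\<nu>. prob_space \<nu> \<and> sets \<nu> = sets (config_space I) \<and>
    weakly_converges (config_topology I) M \<nu>"
proof -
  obtain \<nu> where \<nu>: "prob_space \<nu>" "sets \<nu> = sets (config_space I)"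
    and lim: "\<And>B. B \<in> cylinder_events I \<Longrightarrow> (\<lambda>n. measure (M n) B) \<longlonglongrightarrow> measure \<nu> B"
    using ex_measure_eq_lim_cylinder_events[OF prob sets convergent_cylinder_event[OF prob sets conv]]
    by blast
  have "weakly_converges (config_topology I) M \<nu>"
    unfolding weakly_converges_def
  proof (intro allI impI LIMSEQ_I, elim conjE)
    fix f :: "('v set \<Rightarrow> bool) \<Rightarrow> real" and r :: real
    assume f: "continuous_map (config_topology I) euclidean f"
      and bdd: "bounded (f ` topspace (config_topology I))" and "r > 0"
    then obtain J where J: "finite J" "J \<subseteq> I"
      and approx: "\<And>x. x \<in> I \<rightarrow>\<^sub>E UNIV \<Longrightarrow> \<bar>f x - f (extend_config J I x)\<bar> < r / 3"
      using continuous_map_config_uniform_approx[OF f, of "r / 3"] by auto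
    let ?g = "\<lambda>x. f (extend_config J I x)"
    \<comment> \<open>The bound holds for every probability measure, so one \<open>J\<close> serves
      all \<open>M n\<close> and the limit; the remaining third of \<open>r\<close> is spent on the
      integrals of \<open>?g\<close>.\<close>
    have close: "\<bar>(\<integral>x. f x \<partial>N) - (\<integral>x. ?g x \<partial>N)\<bar> \<le> r / 3"
      if N: "prob_space N" "sets N = sets (config_space I)" for N
    proof -
      interpret N: prob_space N by fact
      have space: "space N = I \<rightarrow>\<^sub>E UNIV"
        using sets_eq_imp_space_eq[OF N(2)] by (simp add: space_config_space)
      have int: "integrable N f" "integrable N ?g"
        using integrable_continuous_config[OF N f bdd] integrable_function_of_extend_config[OF N J] by auto
      have bound: "f x - ?g x \<le> r / 3" "?g x - f x \<le> r / 3" if "x \<in> space N" for x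
        using approx[OF that[unfolded space]] by linarith+
      have "(\<integral>x. f x - ?g x \<partial>N) \<le> r / 3" "(\<integral>x. ?g x - f x \<partial>N) \<le> r / 3"
        using bound by (intro N.integral_le_const AE_I2 Bochner_Integration.integrable_diff int; simp)+
      then show ?thesis
        unfolding Bochner_Integration.integral_diff[OF int] Bochner_Integration.integral_diff[OF int(2,1)]
        by linarith
    qed
    have "(\<lambda>n. \<integral>x. ?g x \<partial>M n) \<longlonglongrightarrow> (\<integral>x. ?g x \<partial>\<nu>)"
      unfolding integral_function_of_extend_config[OF prob sets J] integral_function_of_extend_config[OF \<nu> J]
      by (intro tendsto_sum tendsto_mult tendsto_const lim pattern_in_cylinder_events J)
    then obtain n0 where n0: "\<And>n. n \<ge> n0 \<Longrightarrow> \<bar>(\<integral>x. ?g x \<partial>M n) - (\<integral>x. ?g x \<partial>\<nu>)\<bar> < r / 3"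
      using LIMSEQ_D[of _ _ "r / 3"] \<open>r > 0\<close> by fastforce
    have "norm ((\<integral>x. f x \<partial>M n) - (\<integral>x. f x \<partial>\<nu>)) < r" if "n \<ge> n0" for n
      using close[OF prob sets, of n] close[OF \<nu>] n0[OF that] unfolding real_norm_def by linarith
    then show "\<exists>n0. \<forall>n\<ge>n0. norm ((\<integral>x. f x \<partial>M n) - (\<integral>x. f x \<partial>\<nu>)) < r"
      by blast
  qed
  with \<nu> show ?thesis by blast
qed

section \<open>The random adjacency matrices\<close>

abbreviation edge_weight :: "real \<Rightarrow> real \<Rightarrow> 'v set \<Rightarrow> 'v set set \<Rightarrow> real" where
  "edge_weight \<alpha> \<beta> V A \<equiv> 1 / sqrt (Determinant.det (Q_set \<alpha> \<beta> V A))"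

lemma edge_weight_log_supermodular:
  assumes "finite V" "\<alpha> > 0" "\<beta> \<ge> 0" "finite E" "A \<subseteq> E" "B \<subseteq> E"
  shows "edge_weight \<alpha> \<beta> V A * edge_weight \<alpha> \<beta> V B \<le>
    edge_weight \<alpha> \<beta> V (A \<union> B) * edge_weight \<alpha> \<beta> V (A \<inter> B)"
proof -
  let ?d = "\<lambda>A. Determinant.det (Q_set \<alpha> \<beta> V A)"
  have pos: "?d X > 0" if "X \<subseteq> E" for X
    using assms that finite_subset by (intro det_Q_set_pos) blast+
  have "?d (A \<union> B) * ?d (A \<inter> B) \<le> ?d A * ?d B"
    using assms finite_subset[of _ E] by (intro submodular_if_local[of E] pos det_Q_set_local_submodular) auto
  then have "1 / sqrt (?d A * ?d B) \<le> 1 / sqrt (?d (A \<union> B) * ?d (A \<inter> B))"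
    using pos[of "A \<union> B"] pos[of "A \<inter> B"] pos[OF assms(5)] pos[OF assms(6)] assms(5,6)
    by (intro divide_left_mono real_sqrt_le_mono mult_pos_pos real_sqrt_gt_zero) auto
  then show ?thesis
    by (simp add: real_sqrt_mult)
qed

lemma sum_config_eq_sum_Pow:
  assumes "S \<subseteq> F"
  shows "(\<Sum>a | a \<in> F \<rightarrow>\<^sub>E UNIV \<and> (\<forall>s\<in>S. a s). h {e\<in>F. a e}) = (\<Sum>A | A \<subseteq> F \<and> S \<subseteq> A. h A)"
  using assms
  by (intro sum.reindex_bij_witness[of _ "\<lambda>A. \<lambda>e\<in>F. e \<in> A" "\<lambda>a. {e\<in>F. a e}"])
    (auto simp: PiE_iff extensional_def fun_eq_iff)

context
  fixes \<alpha> \<beta> :: real and V :: "'v set" and F :: "'v set set"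
  assumes \<alpha>: "\<alpha> > 0" and \<beta>: "\<beta> \<ge> 0" and graph: "finite_simple_graph V F"
begin

lemma finite_graph: "finite V" "finite F"
  using graph finite_subset[of F "Pow V"] by (auto simp: finite_simple_graph_def)

lemma edge_weight_pos: "A \<subseteq> F \<Longrightarrow> edge_weight \<alpha> \<beta> V A > 0"
  using finite_graph \<alpha> \<beta> finite_subset[of A F] by (simp add: det_Q_set_pos)

lemma sum_edge_weight_pos: "(\<Sum>A\<in>Pow F. edge_weight \<alpha> \<beta> V A) > 0"
  using finite_graph by (intro sum_pos edge_weight_pos) auto

lemma sum_adj_prob:
  assumes "S \<subseteq> F"
  shows "(\<Sum>a | a \<in> F \<rightarrow>\<^sub>E UNIV \<and> (\<forall>s\<in>S. a s). adj_prob \<alpha> \<beta> V F a) =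
    (\<Sum>A | A \<subseteq> F \<and> S \<subseteq> A. edge_weight \<alpha> \<beta> V A) / (\<Sum>A\<in>Pow F. edge_weight \<alpha> \<beta> V A)"
proof -
  have "(\<Sum>b\<in>F \<rightarrow>\<^sub>E UNIV. adj_weight \<alpha> \<beta> V F b) = (\<Sum>A\<in>Pow F. edge_weight \<alpha> \<beta> V A)"
    using sum_config_eq_sum_Pow[of "{}" F "edge_weight \<alpha> \<beta> V"] finite_graph \<alpha> \<beta>
    by (simp add: adj_weight_eq Pow_def)
  then show ?thesis
    unfolding adj_prob_def sum_divide_distrib[symmetric]
    using sum_config_eq_sum_Pow[OF assms, of "edge_weight \<alpha> \<beta> V"] finite_graph \<alpha> \<beta>
    by (simp add: adj_weight_eq)
qed

lemma adj_prob_nonneg: "adj_prob \<alpha> \<beta> V F a \<ge> 0"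
proof -
  have "adj_weight \<alpha> \<beta> V F b \<ge> 0" for b
    using finite_graph \<alpha> \<beta> edge_weight_pos[of "{e\<in>F. b e}"] by (simp add: adj_weight_eq less_imp_le)
  then show ?thesis
    by (simp add: adj_prob_def sum_nonneg)
qed

lemma emeasure_adj_measure:
  assumes "X \<subseteq> F \<rightarrow>\<^sub>E UNIV"
  shows "emeasure (adj_measure \<alpha> \<beta> V F) X = ennreal (\<Sum>a\<in>X. adj_prob \<alpha> \<beta> V F a)"
proof -
  have "finite (F \<rightarrow>\<^sub>E (UNIV :: bool set))"
    using finite_graph by (intro finite_PiE) auto
  then show ?thesis
    using assms by (simp add: adj_measure_def emeasure_point_measure_finite adj_prob_nonneg)
qed

lemma measurable_extend_config:
  "extend_config F I \<in> measurable (adj_measure \<alpha> \<beta> V F) (config_space I)"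
  by (simp add: adj_measure_def space_config_space extend_config_in_space)

lemma prob_space_extended_adj_measure: "prob_space (extended_adj_measure \<alpha> \<beta> V F I)"
proof -
  have "prob_space (adj_measure \<alpha> \<beta> V F)"
  proof (rule prob_spaceI)
    show "emeasure (adj_measure \<alpha> \<beta> V F) (space (adj_measure \<alpha> \<beta> V F)) = 1"
      using sum_adj_prob[of "{}"] sum_edge_weight_pos
      by (simp add: emeasure_adj_measure adj_measure_def[THEN arg_cong[of _ _ space]] space_point_measure Pow_def)
  qed
  then show ?thesis
    unfolding extended_adj_measure_def using measurable_extend_config by (rule prob_space.prob_space_distr)
qed

lemma measure_extended_adj_measure:
  assumes "finite S" "S \<subseteq> F" "F \<subseteq> I"
  shows "measure (extended_adj_measure \<alpha> \<beta> V F I) (pattern I S S) =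
    (\<Sum>A | A \<subseteq> F \<and> S \<subseteq> A. edge_weight \<alpha> \<beta> V A) / (\<Sum>A\<in>Pow F. edge_weight \<alpha> \<beta> V A)"
proof -
  have space: "space (adj_measure \<alpha> \<beta> V F) = F \<rightarrow>\<^sub>E UNIV"
    by (simp add: adj_measure_def space_point_measure)
  have "measure (extended_adj_measure \<alpha> \<beta> V F I) (pattern I S S) =
      measure (adj_measure \<alpha> \<beta> V F) (extend_config F I -` pattern I S S \<inter> (F \<rightarrow>\<^sub>E UNIV))"
    unfolding extended_adj_measure_def space[symmetric]
    using assms by (intro measure_distr measurable_extend_config sets_pattern) auto
  \<comment> \<open>Padding with 0 does not affect this event because
    \<open>S \<subseteq> F\<close>.\<close>
  also have "extend_config F I -` pattern I S S \<inter> (F \<rightarrow>\<^sub>E UNIV) = {a. a \<in> F \<rightarrow>\<^sub>E UNIV \<and> (\<forall>s\<in>S. a s)}"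
    using assms by (auto simp: pattern_def extend_config_def)
  also have "measure (adj_measure \<alpha> \<beta> V F) \<dots> =
      (\<Sum>a | a \<in> F \<rightarrow>\<^sub>E UNIV \<and> (\<forall>s\<in>S. a s). adj_prob \<alpha> \<beta> V F a)"
    unfolding measure_def by (subst emeasure_adj_measure) (auto simp: sum_nonneg adj_prob_nonneg)
  finally show ?thesis
    using assms by (simp only: sum_adj_prob)
qed

text \<open>The constant does not depend on \<open>A\<close>, so it cancels in every quotient of
  sums of weights.\<close>

lemma edge_weight_vertices:
  assumes "finite V'" "V \<subseteq> V'"
  obtains c where "c > 0" "\<And>A. A \<subseteq> F \<Longrightarrow> edge_weight \<alpha> \<beta> V A = c * edge_weight \<alpha> \<beta> V' A"
proof (rule that)
  \<comment> \<open>The reciprocal square root of the determinant identity in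
    \<open>det_Q_set_vertices\<close>.\<close>
  let ?c = "sqrt (\<alpha> ^ card V') / sqrt (\<alpha> ^ card V)"
  show "?c > 0" using \<alpha> by simp
  fix A assume A: "A \<subseteq> F"
  then have fin: "finite A" and gr: "finite_simple_graph V A"
    using graph finite_graph finite_subset by (auto simp: finite_simple_graph_def)
  have "0 < Determinant.det (Q_set \<alpha> \<beta> V A)" "0 < Determinant.det (Q_set \<alpha> \<beta> V' A)"
    using assms fin finite_graph \<alpha> \<beta> by (auto intro!: det_Q_set_pos)
  moreover have "sqrt (\<alpha> ^ card V) * sqrt (Determinant.det (Q_set \<alpha> \<beta> V' A)) =
      sqrt (\<alpha> ^ card V') * sqrt (Determinant.det (Q_set \<alpha> \<beta> V A))"
    using det_Q_set_vertices[OF assms \<alpha> gr fin, of \<beta>] by (simp add: real_sqrt_mult[symmetric])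
  ultimately show "edge_weight \<alpha> \<beta> V A = ?c * edge_weight \<alpha> \<beta> V' A"
    using \<alpha> by (simp add: field_simps)
qed

end

text \<open>The vertex set is enlarged first, with the edge set fixed, which leaves the probability
  unchanged; then the edge set is enlarged over the fixed \<open>V'\<close>, where the weights are
  comparable.\<close>

lemma measure_extended_adj_measure_mono:
  assumes \<alpha>: "\<alpha> > 0" and \<beta>: "\<beta> \<ge> 0"
    and graph: "finite_simple_graph V F" "finite_simple_graph V' F'"
    and sub: "V \<subseteq> V'" "F \<subseteq> F'" "F' \<subseteq> I" and S: "finite S" "S \<subseteq> F"
  shows "measure (extended_adj_measure \<alpha> \<beta> V F I) (pattern I S S) \<le>
    measure (extended_adj_measure \<alpha> \<beta> V' F' I) (pattern I S S)"
proof -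
  note fin = finite_graph[OF \<alpha> \<beta> graph(2)]
  obtain c where c: "c > 0" "\<And>A. A \<subseteq> F \<Longrightarrow> edge_weight \<alpha> \<beta> V A = c * edge_weight \<alpha> \<beta> V' A"
    using edge_weight_vertices[OF \<alpha> \<beta> graph(1) fin(1) sub(1)] by blast
  have "(\<Sum>A | A \<subseteq> F \<and> S \<subseteq> A. edge_weight \<alpha> \<beta> V A) = c * (\<Sum>A | A \<subseteq> F \<and> S \<subseteq> A. edge_weight \<alpha> \<beta> V' A)"
    "(\<Sum>A\<in>Pow F. edge_weight \<alpha> \<beta> V A) = c * (\<Sum>A\<in>Pow F. edge_weight \<alpha> \<beta> V' A)"
    unfolding sum_distrib_left by (rule sum.cong[OF refl], rule c(2), simp)+
  then have "(\<Sum>A | A \<subseteq> F \<and> S \<subseteq> A. edge_weight \<alpha> \<beta> V A) / (\<Sum>A\<in>Pow F. edge_weight \<alpha> \<beta> V A) =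
      (\<Sum>A | A \<subseteq> F \<and> S \<subseteq> A. edge_weight \<alpha> \<beta> V' A) / (\<Sum>A\<in>Pow F. edge_weight \<alpha> \<beta> V' A)"
    by (simp only: nonzero_mult_divide_mult_cancel_left[OF less_imp_neq[OF c(1), symmetric]])
  also have "\<dots> \<le> (\<Sum>A | A \<subseteq> F' \<and> S \<subseteq> A. edge_weight \<alpha> \<beta> V' A) / (\<Sum>A\<in>Pow F'. edge_weight \<alpha> \<beta> V' A)"
    using fin \<alpha> \<beta> sub
    by (intro log_supermodular_restrict edge_weight_pos[OF \<alpha> \<beta> graph(2)]
        edge_weight_log_supermodular[where E = F']) auto
  finally show ?thesis
    unfolding measure_extended_adj_measure[OF \<alpha> \<beta> graph(1) S subset_trans[OF sub(2,3)]]
      measure_extended_adj_measure[OF \<alpha> \<beta> graph(2) S(1) subset_trans[OF S(2) sub(2)] sub(3)] .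
qed

theorem proposition6:
  fixes \<alpha> \<beta> :: real
    and V :: "nat \<Rightarrow> 'v set"
    and E :: "nat \<Rightarrow> 'v set set"
  assumes "\<alpha> > 0" and "\<beta> \<ge> 0"
    and "\<And>n. finite_simple_graph (V n) (E n)"
    and "\<And>n. V n \<subseteq> V (Suc n)"
    and "\<And>n. E n \<subseteq> E (Suc n)"
    and "filterlim (\<lambda>n. card (E n)) at_top sequentially"
  shows "\<exists>\<nu>. prob_space \<nu> \<and> sets \<nu> = sets (config_space (\<Union>n. E n)) \<and>
    weakly_converges (config_topology (\<Union>n. E n))
      (\<lambda>n. extended_adj_measure \<alpha> \<beta> (V n) (E n) (\<Union>m. E m)) \<nu>"
proof (rule ex_weak_limit)
  let ?I = "\<Union>n. E n"
  let ?M = "\<lambda>n. extended_adj_measure \<alpha> \<beta> (V n) (E n) ?I"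
  show prob: "prob_space (?M n)" for n
    using assms by (intro prob_space_extended_adj_measure)
  show "sets (?M n) = sets (config_space ?I)" for n
    by (simp add: extended_adj_measure_def)
  fix S assume S: "finite S" "S \<subseteq> ?I"
  have incE: "incseq E"
    using assms(5) by (rule incseq_SucI)
  obtain n0 where n0: "S \<subseteq> E n0"
    using S
  proof (induction S arbitrary: thesis rule: finite_induct)
    case (insert e S)
    obtain m where m: "S \<subseteq> E m" using insert by blast
    obtain k where k: "e \<in> E k" using insert by blast
    have "insert e S \<subseteq> E (max m k)"
      using m k incseqD[OF incE, of m "max m k"] incseqD[OF incE, of k "max m k"] by auto
    then show ?case by (rule insert.prems)
  qed auto
  \<comment> \<open>The shift by \<open>n0\<close> puts \<open>S\<close> inside every edge set
    considered, as the formula for the probabilities requires; \<open>LIMSEQ_offset\<close> removes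
    it at the end.\<close>
  let ?p = "\<lambda>n. measure (?M (n + n0)) (pattern ?I S S)"
  have "incseq ?p"
  proof (rule incseq_SucI)
    fix n
    have "S \<subseteq> E (n + n0)"
      using n0 incseqD[OF incE, of n0 "n + n0"] by auto
    then show "?p n \<le> ?p (Suc n)"
      using assms S(1) by (intro measure_extended_adj_measure_mono) auto
  qed
  moreover have "?p n \<le> 1" for n
    using prob by (rule prob_space.prob_le_1)
  ultimately obtain l where "?p \<longlonglongrightarrow> l"
    using incseq_convergent[of ?p 1] by blast
  then show "convergent (\<lambda>n. measure (?M n) (pattern ?I S S))"
    by (intro convergentI) (rule LIMSEQ_offset)
qed

end
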